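(* Let $S \subset \mathbb{P}^3$ be a surface of degree $4$ defined over $\mathbb{F}_4$, irreducible over $\mathbb{F}_4$, and containing no $\mathbb{F}_4$-line. Then $N_4(S) \leq 51$ (which is the value $(d-1)(q^{n-1}+1)+(d-2)(\theta_q(n-3)-1)$ for $n=3$, $d=q=4$).
   Context: $N_4(S)$ denotes the number of $\mathbb{F}_4$-rational points of $S$. An $\mathbb{F}_4$-line is a line in $\mathbb{P}^3$ defined over $\mathbb{F}_4$. $\theta_q(s)=\frac{q^{s+1}-1}{q-1}$. *)

theory Defs
  imports Main "HOL-Library.Poly_Mapping" "HOL-Computational_Algebra.Factorial_Ring"
begin

datatype f4 = F0 | F1 | Fa | Fb  (* Fb = a + 1 = a^2 *)

instantiation f4 :: field
begin

fun plus_f4 :: "f4 \<Rightarrow> f4 \<Rightarrow> f4" where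
  "plus_f4 F0 y = y"
| "plus_f4 x F0 = x"
| "plus_f4 F1 F1 = F0" | "plus_f4 F1 Fa = Fb" | "plus_f4 F1 Fb = Fa"
| "plus_f4 Fa F1 = Fb" | "plus_f4 Fa Fa = F0" | "plus_f4 Fa Fb = F1"
| "plus_f4 Fb F1 = Fa" | "plus_f4 Fb Fa = F1" | "plus_f4 Fb Fb = F0"

fun times_f4 :: "f4 \<Rightarrow> f4 \<Rightarrow> f4" where
  "times_f4 F0 y = F0"
| "times_f4 x F0 = F0"
| "times_f4 F1 y = y"
| "times_f4 x F1 = x"
| "times_f4 Fa Fa = Fb" | "times_f4 Fa Fb = F1"
| "times_f4 Fb Fa = F1" | "times_f4 Fb Fb = Fa"

definition zero_f4 :: f4 where "zero_f4 = F0"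
definition one_f4 :: f4 where "one_f4 = F1"
definition uminus_f4 :: "f4 \<Rightarrow> f4" where "uminus_f4 x = x"
definition minus_f4 :: "f4 \<Rightarrow> f4 \<Rightarrow> f4" where "minus_f4 x y = x + y"

fun inverse_f4 :: "f4 \<Rightarrow> f4" where
  "inverse_f4 F0 = F0" | "inverse_f4 F1 = F1" | "inverse_f4 Fa = Fb" | "inverse_f4 Fb = Fa"

definition divide_f4 :: "f4 \<Rightarrow> f4 \<Rightarrow> f4" where "divide_f4 x y = x * inverse y"

instance
proof
  fix x y z :: f4
  show "x + y + z = x + (y + z)" by (cases x; cases y; cases z) auto
  show "x + y = y + x" by (cases x; cases y) auto
  show "0 + x = x" by (simp add: zero_f4_def)
  show "- x + x = 0" by (cases x) (auto simp: uminus_f4_def zero_f4_def)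
  show "x - y = x + - y" by (simp add: minus_f4_def uminus_f4_def)
  show "x * y * z = x * (y * z)" by (cases x; cases y; cases z) auto
  show "x * y = y * x" by (cases x; cases y) auto
  show "1 * x = x" by (cases x) (auto simp: one_f4_def)
  show "(x + y) * z = x * z + y * z" by (cases x; cases y; cases z) auto
  show "(0::f4) \<noteq> 1" by (simp add: zero_f4_def one_f4_def)
  show "x \<noteq> 0 \<Longrightarrow> times (inverse x) x = 1" by (cases x) (auto simp: zero_f4_def one_f4_def)
  show "divide x y = x * inverse y" by (simp add: divide_f4_def)
  show "inverse (0::f4) = 0" by (simp add: zero_f4_def)
qed

end

lemma UNIV_f4: "(UNIV :: f4 set) = {F0, F1, Fa, Fb}"
  by (auto intro: f4.exhaust)

text \<open>A polynomial is a finitely supported map from monomials (exponent vectors,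
  finitely supported maps nat to nat) to coefficients.\<close>

type_synonym mpoly4 = "(nat \<Rightarrow>\<^sub>0 nat) \<Rightarrow>\<^sub>0 f4"

definition mvar :: "nat \<Rightarrow> mpoly4" where
  "mvar i = Poly_Mapping.single (Poly_Mapping.single i 1) 1"

definition mconst :: "f4 \<Rightarrow> mpoly4" where
  "mconst c = Poly_Mapping.single 0 c"

definition mon_deg :: "(nat \<Rightarrow>\<^sub>0 nat) \<Rightarrow> nat" where
  "mon_deg m = (\<Sum>i\<in>Poly_Mapping.keys m. Poly_Mapping.lookup m i)"

definition is_form_P3 :: "nat \<Rightarrow> mpoly4 \<Rightarrow> bool" where
  "is_form_P3 d F \<longleftrightarrow> F \<noteq> 0 \<and>
     (\<forall>m\<in>Poly_Mapping.keys F. Poly_Mapping.keys m \<subseteq> {0..<4} \<and> mon_deg m = d)"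

definition eval4 :: "mpoly4 \<Rightarrow> (nat \<Rightarrow> f4) \<Rightarrow> f4" where
  "eval4 F x = (\<Sum>m\<in>Poly_Mapping.keys F.
      Poly_Mapping.lookup F m * (\<Prod>i<4. x i ^ Poly_Mapping.lookup m i))"

definition vec4 :: "(nat \<Rightarrow> f4) set" where
  "vec4 = {x. \<forall>i\<ge>4. x i = 0}"

definition proj_class :: "(nat \<Rightarrow> f4) \<Rightarrow> (nat \<Rightarrow> f4) set" where
  "proj_class x = {(\<lambda>i. c * x i) | c. c \<noteq> 0}"

definition P3_F4 :: "(nat \<Rightarrow> f4) set set" where
  "P3_F4 = proj_class ` (vec4 - {\<lambda>_. 0})"

definition N4 :: "mpoly4 \<Rightarrow> nat" where
  "N4 F = card {p \<in> P3_F4. \<forall>x\<in>p. eval4 F x = 0}"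

text \<open>The restriction of F to the line through the points [P] and [Q]: the binary
  form F(s P + t Q) in the variables s = x_0, t = x_1.\<close>
definition restrict_line :: "mpoly4 \<Rightarrow> (nat \<Rightarrow> f4) \<Rightarrow> (nat \<Rightarrow> f4) \<Rightarrow> mpoly4" where
  "restrict_line F P Q = (\<Sum>m\<in>Poly_Mapping.keys F.
      mconst (Poly_Mapping.lookup F m) *
      (\<Prod>i<4. (mconst (P i) * mvar 0 + mconst (Q i) * mvar 1) ^ Poly_Mapping.lookup m i))"

text \<open>An F_4-line is spanned by two linearly independent vectors P, Q of F_4^4;
  it lies on the surface V(F) iff F vanishes identically on it (as a polynomial).\<close>
definition contains_F4_line :: "mpoly4 \<Rightarrow> bool" where
  "contains_F4_line F \<longleftrightarrow> (\<exists>P\<in>vec4. \<exists>Q\<in>vec4.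
      P \<noteq> (\<lambda>_. 0) \<and> (\<forall>c. Q \<noteq> (\<lambda>i. c * P i)) \<and> restrict_line F P Q = 0)"

end

theory Submission
  imports Defs "HOL-Library.Product_Plus" "HOL.Vector_Spaces"
begin

text \<open>
  Let $B$ be the set of rational points off the surface $S$ and suppose $|B| \<le> 33$. Every line
  meets $B$. A quartic form on an affine plane over $F_4$ is orthogonal to the affine functions
  (total degree $5 < 6$), so a plane section of $B$ with at most seven points contains no line; a
  blocking set of at most seven points without a line has exactly seven and meets every line of
  the plane in 1 or 3 points. For a point $Q$ of $S$, give each line through $Q$ the weight
  $|B \<inter> \<ell>| - 1$. In the quotient plane at $Q$ the total weight is at most 12, every line has weight at
  least 2, and weight exactly 2 is carried by a single point. This forces a line all of whose
  points have weight at least 2, i.e. a plane through $Q$ with at least 15 points of $B$, hence at most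
  6 points of $S$. At least nine such planes are needed to cover the 52 or more points of $S$, but
  already six of them, meeting pairwise in at most five points, do not fit into 33 points.
\<close>

subsection \<open>The projective plane of order four\<close>

instance f4 :: finite
  by standard (simp add: UNIV_f4)

lemma sum_f4: "(\<Sum>a\<in>UNIV. g a) = g 0 + g 1 + g Fa + g Fb" for g :: "f4 \<Rightarrow> 'b::comm_monoid_add"
  by (simp add: UNIV_f4 zero_f4_def one_f4_def add.assoc)

text \<open>The points are represented by the vectors whose first nonzero coordinate is 1. The same
  vectors represent the lines: the line \<open>h\<close> consists of the points in \<open>polar h\<close>, so \<open>polar p\<close> is also
  the set of lines through the point \<open>p\<close>.\<close>

definition PG :: "(f4 \<times> f4 \<times> f4) set" where
  "PG = {(x, y, z). x = 1 \<or> (x = 0 \<and> y = 1) \<or> (x = 0 \<and> y = 0 \<and> z = 1)}"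

fun dot :: "f4 \<times> f4 \<times> f4 \<Rightarrow> f4 \<times> f4 \<times> f4 \<Rightarrow> f4" where
  "dot (a, b, c) (x, y, z) = a * x + b * y + c * z"

definition polar :: "f4 \<times> f4 \<times> f4 \<Rightarrow> (f4 \<times> f4 \<times> f4) set" where
  "polar h = {p \<in> PG. dot h p = 0}"

text \<open>The enumeration uses the constructors of \<open>f4\<close> instead of 0 and 1, so that
  incidence counts can be settled by evaluation.\<close>

definition PG_list :: "(f4 \<times> f4 \<times> f4) list" where
  "PG_list = (let l = [F0, F1, Fa, Fb] in
    (F0, F0, F1) # map (\<lambda>z. (F0, F1, z)) l @ concat (map (\<lambda>y. map (\<lambda>z. (F1, y, z)) l) l))"

lemma PG_eq: "PG = set PG_list"
proof -
  have "(x, y, z) \<in> PG \<longleftrightarrow> (x, y, z) \<in> set PG_list" for x y z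
    by (cases x; cases y; cases z) (simp_all add: PG_def PG_list_def zero_f4_def one_f4_def)
  then show ?thesis by auto
qed

lemma distinct_PG_list: "distinct PG_list" by code_simp

lemma length_polar_list: "\<forall>h\<in>set PG_list. length (filter (\<lambda>p. dot h p = F0) PG_list) = 5"
  by code_simp

lemma length_polar_Int_list: "\<forall>h\<in>set PG_list. \<forall>k\<in>set PG_list. h = k \<or> length (filter (\<lambda>p. dot h p = F0 \<and> dot k p = F0) PG_list) = 1"
  by code_simp

lemma finite_PG [simp]: "finite PG"
  by simp

lemma card_PG: "card PG = 21"
proof -
  have "length PG_list = 21" by code_simp
  then show ?thesis by (metis PG_eq distinct_PG_list distinct_card)
qed

lemma polarD: "p \<in> polar h \<Longrightarrow> p \<in> PG"
  by (auto simp: polar_def)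

lemma dot_commute: "dot h p = dot p h"
  by (cases h; cases p) (simp add: mult.commute)

lemma polar_sym: "h \<in> PG \<Longrightarrow> p \<in> polar h \<Longrightarrow> h \<in> polar p"
  by (auto simp: polar_def dot_commute)

lemma card_polar: "h \<in> PG \<Longrightarrow> card (polar h) = 5"
proof -
  assume h: "h \<in> PG"
  have "polar h = set (filter (\<lambda>p. dot h p = F0) PG_list)"
    by (auto simp: polar_def PG_eq zero_f4_def)
  moreover have "distinct (filter (\<lambda>p. dot h p = F0) PG_list)"
    using distinct_PG_list by simp
  ultimately have "card (polar h) = length (filter (\<lambda>p. dot h p = F0) PG_list)"
    by (simp only: distinct_card)
  also have "\<dots> = 5" using length_polar_list h unfolding PG_eq by (rule bspec)
  finally show ?thesis .
qed

lemma card_polar_Int: "h \<in> PG \<Longrightarrow> k \<in> PG \<Longrightarrow> h \<noteq> k \<Longrightarrow> card (polar h \<inter> polar k) = 1"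
proof -
  assume h: "h \<in> PG" "k \<in> PG" "h \<noteq> k"
  let ?l = "filter (\<lambda>p. dot h p = F0 \<and> dot k p = F0) PG_list"
  have "polar h \<inter> polar k = set ?l"
    by (auto simp: polar_def PG_eq zero_f4_def)
  moreover have "distinct ?l"
    using distinct_PG_list by simp
  ultimately have "card (polar h \<inter> polar k) = length ?l"
    by (simp only: distinct_card)
  also have "\<dots> = 1" using length_polar_Int_list h unfolding PG_eq by blast
  finally show ?thesis .
qed

section \<open>Counting weights along the lines through a point\<close>

text \<open>The five lines through \<open>p\<close> cover \<open>p\<close> five times and every
  other point exactly once.\<close>

lemma sum_polar_polar:
  fixes e :: "f4 \<times> f4 \<times> f4 \<Rightarrow> nat"
  assumes p: "p \<in> PG"
  shows "(\<Sum>h\<in>polar p. sum e (polar h)) = sum e PG + 4 * e p"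
proof -
  have "(\<Sum>h\<in>polar p. sum e (polar h)) = (\<Sum>h\<in>polar p. \<Sum>q\<in>PG. if dot h q = 0 then e q else 0)"
    unfolding polar_def by (simp only: sum.inter_filter finite_PG)
  also have "\<dots> = (\<Sum>q\<in>PG. \<Sum>h\<in>polar p. if dot h q = 0 then e q else 0)"
    by (rule sum.swap)
  \<comment> \<open>The lines through both \<open>p\<close> and \<open>q\<close> form
    \<open>polar p \<inter> polar q\<close>: five of them for \<open>q = p\<close>, otherwise
    one.\<close>
  also have "\<dots> = (\<Sum>q\<in>PG. e q * card (polar p \<inter> polar q))"
  proof (rule sum.cong)
    fix q
    have "(\<Sum>h\<in>polar p. if dot h q = 0 then e q else 0) = (\<Sum>h\<in>{h \<in> polar p. dot h q = 0}. e q)"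
      by (rule sum.inter_filter [symmetric]) simp
    also have "{h \<in> polar p. dot h q = 0} = polar p \<inter> polar q"
      by (auto simp: polar_def dot_commute)
    finally show "(\<Sum>h\<in>polar p. if dot h q = 0 then e q else 0) = e q * card (polar p \<inter> polar q)"
      by simp
  qed simp
  also have "\<dots> = (\<Sum>q\<in>PG. e q + (if q = p then 4 * e q else 0))"
  proof (rule sum.cong)
    fix q assume "q \<in> PG"
    then show "e q * card (polar p \<inter> polar q) = e q + (if q = p then 4 * e q else 0)"
      using p card_polar card_polar_Int [of p q] by (cases "q = p") auto
  qed simp
  also have "\<dots> = sum e PG + 4 * e p"
    using p by (simp add: sum.distrib)
  finally show ?thesis .
qed

text \<open>The total over the pencil at \<open>p\<close> is known, so lower bounds for its other
  four lines bound \<open>h\<close> from above; \<open>polar_sum_upper\<close> is the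
  reverse.\<close>

lemma polar_sum_lower:
  fixes e :: "f4 \<times> f4 \<times> f4 \<Rightarrow> nat"
  assumes p: "p \<in> PG" and h: "h \<in> polar p"
    and k: "\<And>h'. h' \<in> polar p \<Longrightarrow> h' \<noteq> h \<Longrightarrow> k \<le> sum e (polar h')"
  shows "sum e (polar h) + 4 * k \<le> sum e PG + 4 * e p"
proof -
  have "4 * k = (\<Sum>h'\<in>polar p - {h}. k)"
    using card_polar [OF p] h by simp
  also have "\<dots> \<le> (\<Sum>h'\<in>polar p - {h}. sum e (polar h'))"
    by (rule sum_mono) (use k in auto)
  finally show ?thesis
    using sum_polar_polar [OF p, of e] sum.remove [OF _ h, of "\<lambda>h. sum e (polar h)"] by simp
qed

lemma polar_sum_upper:
  fixes e :: "f4 \<times> f4 \<times> f4 \<Rightarrow> nat"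
  assumes p: "p \<in> PG" and h: "h \<in> polar p"
    and k: "\<And>h'. h' \<in> polar p \<Longrightarrow> h' \<noteq> h \<Longrightarrow> sum e (polar h') \<le> k"
  shows "sum e PG + 4 * e p \<le> sum e (polar h) + 4 * k"
proof -
  have "(\<Sum>h'\<in>polar p - {h}. sum e (polar h')) \<le> (\<Sum>h'\<in>polar p - {h}. k)"
    by (rule sum_mono) (use k in auto)
  also have "\<dots> = 4 * k"
    using card_polar [OF p] h by simp
  finally show ?thesis
    using sum_polar_polar [OF p, of e] sum.remove [OF _ h, of "\<lambda>h. sum e (polar h)"] by simp
qed

section \<open>Small blocking sets\<close>

text \<open>Double counting gives the first two moments of the intersection numbers s. They lie
  between 1 and 3, and (s - 1)(3 - s) sums over all lines to -(7 - n)(9 - n) with n =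
  \<open>card T\<close> \<le> 7. Hence both sides are 0, which forces n = 7 and s = 1 or 3 on every
  line.\<close>

lemma blocking_set_card_7:
  assumes T: "T \<subseteq> PG" and card_T: "card T \<le> 7"
    and blocking: "\<And>h. h \<in> PG \<Longrightarrow> T \<inter> polar h \<noteq> {}"
    and no_line: "\<And>h. h \<in> PG \<Longrightarrow> \<not> polar h \<subseteq> T"
  shows "card T = 7" and "h \<in> PG \<Longrightarrow> card (T \<inter> polar h) \<in> {1, 3}"
proof -
  define e :: "f4 \<times> f4 \<times> f4 \<Rightarrow> nat" where "e p = of_bool (p \<in> T)" for p
  define s where "s h = sum e (polar h)" for h
  have s_card: "s h = card (T \<inter> polar h)" for h
    by (simp add: s_def e_def of_bool_def sum.If_cases Int_commute)
  have E: "sum e PG = card T"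
    using T by (simp add: e_def of_bool_def sum.If_cases Int_absorb1 Collect_mem_eq)
  have ge1: "1 \<le> s h" if "h \<in> PG" for h
    using blocking [OF that] by (simp add: s_card Suc_le_eq card_gt_0_iff)
  \<comment> \<open>At a point of the line outside \<open>T\<close> the other four lines each meet
    \<open>T\<close>, which leaves at most 7 - 4 points for the line itself.\<close>
  have le3: "s h \<le> 3" if "h \<in> PG" for h
  proof -
    obtain p where p: "p \<in> polar h" "p \<notin> T" using no_line [OF \<open>h \<in> PG\<close>] by blast
    have "p \<in> PG" using p polarD by blast
    then have "s h + 4 * 1 \<le> sum e PG + 4 * e p"
      unfolding s_def using that p ge1 [unfolded s_def]
      by (intro polar_sum_lower [OF _ polar_sym]) (blast dest: polarD)+
    then show ?thesis using card_T p unfolding E by (simp add: e_def)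
  qed
  have sum1: "(\<Sum>h\<in>PG. s h) = 5 * card T"
    and sum2: "(\<Sum>h\<in>PG. s h * s h) = card T * (card T + 4)"
  proof -
    \<comment> \<open>Summation over incident pairs in the other order: \<open>g\<close> constantly
      1 gives the first moment, \<open>g = s\<close> the second.\<close>
    have swap: "(\<Sum>h\<in>PG. g h * s h) = (\<Sum>p\<in>PG. e p * sum g (polar p))" for g :: "_ \<Rightarrow> nat"
    proof -
      have "(\<Sum>h\<in>PG. g h * s h) = (\<Sum>h\<in>PG. \<Sum>p\<in>PG. if dot h p = 0 then g h * e p else 0)"
        unfolding s_def polar_def sum_distrib_left by (simp add: sum.inter_filter)
      also have "\<dots> = (\<Sum>p\<in>PG. \<Sum>h\<in>PG. if dot h p = 0 then g h * e p else 0)"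
        by (rule sum.swap)
      also have "\<dots> = (\<Sum>p\<in>PG. e p * sum g (polar p))"
        unfolding polar_def sum_distrib_left by (simp add: sum.inter_filter dot_commute mult.commute cong: if_cong)
      finally show ?thesis .
    qed
    have "(\<Sum>h\<in>PG. s h) = (\<Sum>p\<in>PG. e p * 5)"
      using swap [of "\<lambda>_. 1"] by (simp add: card_polar)
    then show "(\<Sum>h\<in>PG. s h) = 5 * card T"
      by (simp only: E sum_distrib_right [symmetric] mult.commute)
    have "(\<Sum>h\<in>PG. s h * s h) = (\<Sum>p\<in>PG. e p * (card T + 4 * e p))"
      unfolding swap by (rule sum.cong) (simp_all add: s_def sum_polar_polar E)
    also have "\<dots> = (\<Sum>p\<in>PG. e p * (card T + 4))"
      by (rule sum.cong) (auto simp: e_def)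
    finally show "(\<Sum>h\<in>PG. s h * s h) = card T * (card T + 4)"
      by (simp add: E flip: sum_distrib_right)
  qed
  define n where "n = int (card T)"
  \<comment> \<open>The quadratic has its zeros at the extreme values 1 and 3; its constant term
    sums to 3 * 21 = 63.\<close>
  have "(\<Sum>h\<in>PG. (int (s h) - 1) * (3 - int (s h)))
      = (\<Sum>h\<in>PG. 4 * int (s h) - int (s h * s h) - 3)"
    by (rule sum.cong) (simp_all add: algebra_simps)
  also have "\<dots> = 4 * int (\<Sum>h\<in>PG. s h) - int (\<Sum>h\<in>PG. s h * s h) - 63"
    by (simp add: sum_subtractf card_PG flip: sum_distrib_left)
  also have "\<dots> = - ((7 - n) * (9 - n))"
    unfolding sum1 sum2 n_def by (simp add: algebra_simps)
  finally have tot: "(\<Sum>h\<in>PG. (int (s h) - 1) * (3 - int (s h))) = - ((7 - n) * (9 - n))" .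
  have pos: "0 \<le> (int (s h) - 1) * (3 - int (s h))" if "h \<in> PG" for h
    using ge1 [OF that] le3 [OF that] by (intro mult_nonneg_nonneg) auto
  have "0 \<le> (\<Sum>h\<in>PG. (int (s h) - 1) * (3 - int (s h)))"
    by (rule sum_nonneg) (use pos in auto)
  moreover have "0 \<le> (7 - n) * (9 - n)"
    using card_T by (intro mult_nonneg_nonneg) (auto simp: n_def)
  ultimately have zero: "(7 - n) * (9 - n) = 0" "(\<Sum>h\<in>PG. (int (s h) - 1) * (3 - int (s h))) = 0"
    using tot by linarith+
  then show "card T = 7" using card_T by (auto simp: n_def)
  show "card (T \<inter> polar h) \<in> {1, 3}" if h: "h \<in> PG"
  proof -
    have "(int (s h) - 1) * (3 - int (s h)) = 0"
      using zero(2) pos h sum_nonneg_eq_0_iff [OF finite_PG, of "\<lambda>h. (int (s h) - 1) * (3 - int (s h))"] by auto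
    then show ?thesis by (auto simp: s_card)
  qed
qed

text \<open>A line of weight at least 5 cannot contain a point of weight 0 or 1. If all lines have weight
  at most 4, a line joining two points of weight 2 contains a point of weight 0, which forces total
  weight 12; but then all lines through a point of weight 2 have weight 4.\<close>

lemma double_blocking_line:
  fixes e :: "f4 \<times> f4 \<times> f4 \<Rightarrow> nat"
  assumes E: "sum e PG \<le> 12"
    and ge2: "\<And>h. h \<in> PG \<Longrightarrow> 2 \<le> sum e (polar h)"
    and eq2: "\<And>h p. h \<in> PG \<Longrightarrow> sum e (polar h) = 2 \<Longrightarrow> p \<in> polar h \<Longrightarrow> e p \<in> {0, 2}"
  shows "\<exists>h\<in>PG. \<forall>p\<in>polar h. 2 \<le> e p"
proof (cases "\<exists>h\<in>PG. 5 \<le> sum e (polar h)")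
  case True
  then obtain h where h: "h \<in> PG" "5 \<le> sum e (polar h)" by blast
  have "2 \<le> e p" if p: "p \<in> polar h" for p
  proof (rule ccontr)
    assume "\<not> 2 \<le> e p"
    then consider "e p = 0" | "e p = 1" by linarith
    then show False
    proof cases
      case 1
      \<comment> \<open>Together with four further lines of weight at least 2 the total would reach
        5 + 8.\<close>
      have "sum e (polar h) + 4 * 2 \<le> sum e PG + 4 * e p"
        using p h ge2 by (intro polar_sum_lower [OF _ polar_sym]) (blast dest: polarD)+
      then show False using h E 1 by simp
    next
      case 2
      \<comment> \<open>By \<open>eq2\<close> a point of weight 1 lies on no line of weight 2, so
        the pencil at \<open>p\<close> would weigh at least 5 + 12, more than 12 + 4.\<close>
      have "3 \<le> sum e (polar h')" if h': "h' \<in> polar p" for h'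
      proof -
        have "h' \<in> PG" using h' polarD by blast
        moreover have "p \<in> polar h'" using h' p polarD polar_sym by blast
        ultimately have "2 \<le> sum e (polar h')" "sum e (polar h') \<noteq> 2"
          using ge2 [of h'] eq2 [of h' p] 2 by auto
        then show ?thesis by simp
      qed
      then have "sum e (polar h) + 4 * 3 \<le> sum e PG + 4 * e p"
        using p h by (intro polar_sum_lower [OF _ polar_sym]) (blast dest: polarD)+
      then show False using h E 2 by simp
    qed
  qed
  then show ?thesis using h by blast
next
  case False
  have le4: "sum e (polar h) \<le> 4" if "h \<in> PG" for h
  proof -
    have "\<not> 5 \<le> sum e (polar h)" using False that by blast
    then show ?thesis by simp
  qed
  \<comment> \<open>There are 21 points, but the total weight is at most 12.\<close>
  have "\<exists>z\<in>PG. e z = 0"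
  proof (rule ccontr)
    assume "\<not> ?thesis"
    then have "(\<Sum>p\<in>PG. 1) \<le> sum e PG" by (intro sum_mono) (simp add: Suc_le_eq)
    then show False using E card_PG by simp
  qed
  then obtain z where z: "z \<in> PG" "e z = 0" by blast
  have heavy: "\<exists>v\<in>polar h. e v = 2" if "h \<in> PG" "sum e (polar h) = 2" for h
  proof (rule ccontr)
    assume "\<not> ?thesis"
    then have "e v = 0" if "v \<in> polar h" for v
      using eq2 [of h v] that \<open>h \<in> PG\<close> \<open>sum e (polar h) = 2\<close> by blast
    then have "sum e (polar h) = 0" by simp
    then show False using \<open>sum e (polar h) = 2\<close> by simp
  qed
  \<comment> \<open>Otherwise the pencil at \<open>z\<close> would weigh at least 2 + 12. Used
    twice, this gives two different lines of weight 2 through \<open>z\<close>.\<close>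
  have ex2: "\<exists>h'\<in>polar z. h' \<noteq> h \<and> sum e (polar h') = 2" if h: "h \<in> polar z" for h
  proof (rule ccontr)
    assume *: "\<not> ?thesis"
    have "3 \<le> sum e (polar h')" if "h' \<in> polar z" "h' \<noteq> h" for h'
    proof -
      have "h' \<in> PG" using that polarD by blast
      then have "2 \<le> sum e (polar h')" "sum e (polar h') \<noteq> 2"
        using * that ge2 [of h'] by auto
      then show ?thesis by simp
    qed
    then have "sum e (polar h) + 4 * 3 \<le> sum e PG + 4 * e z"
      using h z by (intro polar_sum_lower) auto
    moreover have "2 \<le> sum e (polar h)" using h polarD ge2 by blast
    ultimately show False using E z by simp
  qed
  obtain h0 where "h0 \<in> polar z" using card_polar [OF z(1)] by (metis card.empty ex_in_conv zero_neq_numeral)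
  then obtain h1 where h1: "h1 \<in> polar z" "sum e (polar h1) = 2" using ex2 by blast
  then obtain h2 where h2: "h2 \<in> polar z" "h2 \<noteq> h1" "sum e (polar h2) = 2" using ex2 by blast
  have hPG: "h1 \<in> PG" "h2 \<in> PG" using h1 h2 polarD by blast+
  obtain v1 where v1: "v1 \<in> polar h1" "e v1 = 2" using heavy h1 hPG by blast
  obtain v2 where v2: "v2 \<in> polar h2" "e v2 = 2" using heavy h2 hPG by blast
  have vPG: "v1 \<in> PG" "v2 \<in> PG" using v1 v2 polarD by blast+
  \<comment> \<open>The lines \<open>h1\<close> and \<open>h2\<close> already meet in
    \<open>z\<close>, whose weight is 0.\<close>
  have ne: "v1 \<noteq> v2"
  proof
    assume "v1 = v2"
    then have "{v1, z} \<subseteq> polar h1 \<inter> polar h2"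
      using v1 v2 polar_sym [OF z(1) h1(1)] polar_sym [OF z(1) h2(1)] by simp
    then have "card {v1, z} \<le> 1" using card_polar_Int [OF hPG] h2 card_mono
      by (metis finite)
    then show False using v1 z by (cases "v1 = z") auto
  qed
  obtain h where h: "h \<in> polar v1" "h \<in> polar v2"
    using card_polar_Int [OF vPG ne] by (metis IntD1 IntD2 card.empty ex_in_conv zero_neq_one)
  have hP: "h \<in> PG" using h polarD by blast
  have vh: "v1 \<in> polar h" "v2 \<in> polar h" using polar_sym [OF vPG(1) h(1)] polar_sym [OF vPG(2) h(2)] by simp_all
  \<comment> \<open>The points \<open>v1\<close> and \<open>v2\<close> exhaust the weight 4 allowed
    on their line, so its other three points have weight 0.\<close>
  have split: "sum e (polar h) = 4 + sum e (polar h - {v1, v2})"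
    using vh ne v1 v2 by (subst sum.subset_diff [of "{v1, v2}"]) auto
  have "card (polar h - {v1, v2}) = 3"
    using vh ne card_polar [OF hP] by (simp add: card_Diff_subset)
  then obtain y where y: "y \<in> polar h - {v1, v2}"
    by (metis card.empty ex_in_conv zero_neq_numeral)
  have "e y = 0"
  proof -
    have "sum e (polar h - {v1, v2}) = 0" using split le4 [OF hP] by simp
    then show ?thesis using y by simp
  qed
  \<comment> \<open>The pencil at \<open>y\<close> makes the total at least 4 + 8. The pencil at
    \<open>v1\<close> then weighs at least 12 + 8, but \<open>h1\<close> contributes 2 and the other
    four lines at most 16.\<close>
  have "sum e (polar h) + 4 * 2 \<le> sum e PG + 4 * e y"
    using y hP ge2 by (intro polar_sum_lower [OF _ polar_sym]) (blast dest: polarD)+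
  then have "12 \<le> sum e PG" using split \<open>e y = 0\<close> by simp
  moreover have "sum e PG + 4 * e v1 \<le> sum e (polar h1) + 4 * 4"
    using v1 vPG hPG le4 by (intro polar_sum_upper [OF _ polar_sym]) (blast dest: polarD)+
  ultimately have False using v1 h1 by simp
  then show ?thesis ..
qed

subsection \<open>Planes in four-dimensional space\<close>

type_synonym v4 = "f4 \<times> f4 \<times> f4 \<times> f4"

fun scale3 :: "f4 \<Rightarrow> f4 \<times> f4 \<times> f4 \<Rightarrow> f4 \<times> f4 \<times> f4" where
  "scale3 k (x, y, z) = (k * x, k * y, k * z)"

fun scale4 :: "f4 \<Rightarrow> v4 \<Rightarrow> v4" (infixr "\<cdot>" 75) where
  "scale4 k (x, y, z, t) = (k * x, k * y, k * z, k * t)"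

interpretation V3: vector_space scale3
  by unfold_locales (auto simp: algebra_simps)

interpretation V4: vector_space scale4
  by unfold_locales (auto simp: algebra_simps)

lemma zero3: "(0 :: f4 \<times> f4 \<times> f4) = (0, 0, 0)"
  by (simp add: zero_prod_def)

lemma card_UNIV_f4: "card (UNIV :: f4 set) = 4"
  by (simp add: UNIV_f4)

lemma card_UNIV_v4: "card (UNIV :: v4 set) = 256"
  by (simp add: card_UNIV_f4 flip: UNIV_Times_UNIV)

lemma scale3_PG:
  assumes "r \<noteq> 0"
  obtains c p where "c \<noteq> 0" "p \<in> PG" "r = scale3 c p"
proof -
  obtain x y z where xyz: "r = (x, y, z)" by (cases r)
  consider "x \<noteq> 0" | "x = 0" "y \<noteq> 0" | "x = 0" "y = 0" "z \<noteq> 0"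
    using assms xyz by (auto simp: zero3)
  then show thesis
  proof cases
    case 1
    then show ?thesis by (intro that [of x "(1, y / x, z / x)"]) (auto simp: xyz PG_def)
  next
    case 2
    then show ?thesis by (intro that [of y "(0, 1, z / y)"]) (auto simp: xyz PG_def)
  next
    case 3
    then show ?thesis by (intro that [of z "(0, 0, 1)"]) (auto simp: xyz PG_def)
  qed
qed

lemma scale3_PG_inject:
  "p \<in> PG \<Longrightarrow> q \<in> PG \<Longrightarrow> scale3 c p = scale3 d q \<Longrightarrow> c \<noteq> 0 \<Longrightarrow> p = q \<and> c = d"
  by (auto simp: PG_def)

lemma PG_nonzero: "p \<in> PG \<Longrightarrow> p \<noteq> 0"
  by (auto simp: PG_def zero3)

text \<open>A nonzero vector is a scalar multiple of exactly one normalised vector, so each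
  projective point accounts for three vectors.\<close>

lemma sum_invariant:
  fixes k :: "f4 \<times> f4 \<times> f4 \<Rightarrow> nat"
  assumes inv: "\<And>c p. c \<noteq> 0 \<Longrightarrow> k (scale3 c p) = k p"
  shows "sum k UNIV = k 0 + 3 * sum k PG"
proof -
  have bij: "bij_betw (\<lambda>(c, p). scale3 c p) ((UNIV - {0}) \<times> PG) (UNIV - {0})"
    unfolding bij_betw_def
  proof
    show "inj_on (\<lambda>(c, p). scale3 c p) ((UNIV - {0}) \<times> PG)"
      by (auto simp: inj_on_def PG_def)
    show "(\<lambda>(c, p). scale3 c p) ` ((UNIV - {0}) \<times> PG) = UNIV - {0}"
    proof (intro equalityI subsetI)
      fix r assume "r \<in> (\<lambda>(c, p). scale3 c p) ` ((UNIV - {0}) \<times> PG)"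
      then show "r \<in> UNIV - {0}" by (auto simp: PG_def zero3)
    next
      fix r :: "f4 \<times> f4 \<times> f4" assume r: "r \<in> UNIV - {0}"
      then obtain c p where "c \<noteq> 0" "p \<in> PG" "r = scale3 c p"
        by (auto elim: scale3_PG)
      then show "r \<in> (\<lambda>(c, p). scale3 c p) ` ((UNIV - {0}) \<times> PG)"
        by (intro image_eqI [of _ _ "(c, p)"]) auto
    qed
  qed
  have "sum k UNIV = k 0 + sum k (UNIV - {0})"
    by (simp add: sum.remove [of UNIV 0])
  also have "sum k (UNIV - {0}) = (\<Sum>(c, p)\<in>(UNIV - {0}) \<times> PG. k (scale3 c p))"
    by (subst sum.reindex_bij_betw [OF bij, symmetric]) (simp add: case_prod_unfold)
  also have "\<dots> = (\<Sum>(c, p)\<in>(UNIV - {0 :: f4}) \<times> PG. k p)"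
    by (rule sum.cong) (simp_all add: case_prod_unfold inv mem_Times_iff)
  also have "\<dots> = 3 * sum k PG"
    by (simp add: sum.cartesian_product [symmetric] card_Diff_subset card_UNIV_f4)
  finally show ?thesis .
qed

lemma dot_0: "dot h 0 = 0"
  by (cases h) (simp add: zero3)

lemma dot_add: "dot h (p + q) = dot h p + dot h q"
  by (cases h; cases p; cases q) (simp add: algebra_simps)

lemma dot_scale: "dot h (scale3 c p) = c * dot h p"
  by (cases h; cases p) (simp add: algebra_simps)

definition indep2 :: "v4 \<Rightarrow> v4 \<Rightarrow> bool" where
  "indep2 x y \<longleftrightarrow> (\<forall>a b. a \<cdot> x + b \<cdot> y = 0 \<longrightarrow> a = 0 \<and> b = 0)"

definition comb3 :: "v4 \<Rightarrow> v4 \<Rightarrow> v4 \<Rightarrow> f4 \<times> f4 \<times> f4 \<Rightarrow> v4" where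
  "comb3 x y z p = (case p of (a, b, c) \<Rightarrow> a \<cdot> x + b \<cdot> y + c \<cdot> z)"

lemma comb3_add: "comb3 x y z (p + q) = comb3 x y z p + comb3 x y z q"
  by (cases p; cases q) (simp add: comb3_def algebra_simps V4.scale_left_distrib)

lemma comb3_scale: "comb3 x y z (scale3 c p) = c \<cdot> comb3 x y z p"
  by (cases p) (simp add: comb3_def algebra_simps V4.scale_right_distrib)

lemma comb3_0: "comb3 x y z 0 = 0"
  by (simp add: comb3_def zero3)

lemma comb3_diff: "comb3 x y z (p - q) = comb3 x y z p - comb3 x y z q"
  by (cases p; cases q) (simp add: comb3_def algebra_simps V4.scale_left_diff_distrib)

text \<open>A plane of P^3 as the set of its 4^3 vectors; the cardinality stands in for the
  dimension.\<close>

definition plane :: "v4 set \<Rightarrow> bool" where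
  "plane X \<longleftrightarrow> V4.subspace X \<and> card X = 64"

text \<open>The span of \<open>x\<close> and \<open>y\<close> has at most 16 vectors, so
  \<open>X\<close> contains some \<open>z\<close> outside it; the 64 combinations of
  \<open>x\<close>, \<open>y\<close>, \<open>z\<close> are then distinct and fill
  \<open>X\<close>.\<close>

lemma extend_to_plane_basis:
  assumes X: "plane X" and xy: "x \<in> X" "y \<in> X" "indep2 x y"
  obtains z where "bij_betw (comb3 x y z) UNIV X"
proof -
  have sub: "V4.subspace X" and card_X: "card X = 64" using X by (auto simp: plane_def)
  let ?L = "(\<lambda>(a, b). a \<cdot> x + b \<cdot> y) ` UNIV"
  have "card ?L \<le> card (UNIV :: (f4 \<times> f4) set)"
    by (rule card_image_le) simp
  also have "\<dots> = 16"
    by (simp add: card_UNIV_f4 flip: UNIV_Times_UNIV)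
  finally have "\<not> X \<subseteq> ?L"
    using card_mono [of ?L X] card_X by auto
  then obtain z where z: "z \<in> X" "z \<notin> ?L" by blast
  have ker: "p = 0" if "comb3 x y z p = 0" for p
  proof -
    obtain a b c where p: "p = (a, b, c)" by (cases p)
    have eq: "a \<cdot> x + b \<cdot> y + c \<cdot> z = 0"
      using that by (simp add: comb3_def p)
    have "c = 0"
    proof (rule ccontr)
      assume c: "c \<noteq> 0"
      have "c \<cdot> z = - (a \<cdot> x + b \<cdot> y)"
        using eq by (metis add.commute eq_neg_iff_add_eq_0)
      then have "inverse c \<cdot> c \<cdot> z = inverse c \<cdot> (- (a \<cdot> x + b \<cdot> y))" by simp
      then have "z = (- inverse c * a) \<cdot> x + (- inverse c * b) \<cdot> y"
        using c by (simp add: V4.scale_right_distrib V4.scale_right_diff_distrib)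
      then have "z \<in> ?L"
        by (intro image_eqI [of _ _ "(- inverse c * a, - inverse c * b)"]) simp_all
      then show False using z by simp
    qed
    then show ?thesis using eq xy by (auto simp: p indep2_def zero3)
  qed
  have "inj (comb3 x y z)"
  proof (rule injI)
    fix p q assume "comb3 x y z p = comb3 x y z q"
    then have "comb3 x y z (p - q) = 0" by (simp add: comb3_diff)
    then show "p = q" using ker by fastforce
  qed
  moreover have "range (comb3 x y z) \<subseteq> X"
    using xy z sub by (auto simp: comb3_def intro!: V4.subspace_add V4.subspace_scale)
  moreover have "card (range (comb3 x y z)) = 64"
    using \<open>inj _\<close> by (simp add: card_image card_UNIV_f4 flip: UNIV_Times_UNIV)
  ultimately have "bij_betw (comb3 x y z) UNIV X"
    using card_X by (simp add: bij_betw_def card_subset_eq)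
  then show thesis by (rule that)
qed

text \<open>For \<open>x\<close> in \<open>X\<close> but not in \<open>Y\<close>, the four
  translates of \<open>X \<inter> Y\<close> by multiples of \<open>x\<close> are disjoint subsets of
  \<open>X\<close>.\<close>

lemma plane_Int:
  assumes X: "plane X" and Y: "plane Y" and ne: "X \<noteq> Y"
  shows "card (X \<inter> Y) \<le> 16"
proof -
  have "\<not> X \<subseteq> Y"
    using assms card_subset_eq [of Y X] by (auto simp: plane_def)
  then obtain x where x: "x \<in> X" "x \<notin> Y" by blast
  have sub: "V4.subspace X" "V4.subspace Y" using X Y by (auto simp: plane_def)
  let ?g = "\<lambda>(c, v). c \<cdot> x + v"
  have "inj_on ?g (UNIV \<times> (X \<inter> Y))"
  proof (rule inj_onI, clarify)
    fix c v c' v'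
    assume v: "v \<in> X" "v \<in> Y" "v' \<in> X" "v' \<in> Y" and eq: "c \<cdot> x + v = c' \<cdot> x + v'"
    then have "(c - c') \<cdot> x = v' - v"
      by (simp add: V4.scale_left_diff_distrib algebra_simps)
    then have mem: "(c - c') \<cdot> x \<in> Y" using v sub V4.subspace_diff by simp
    have "c = c'"
    proof (rule ccontr)
      assume "c \<noteq> c'"
      then have "inverse (c - c') \<cdot> (c - c') \<cdot> x = x" by simp
      then have "x \<in> Y" using V4.subspace_scale [OF sub(2) mem] by metis
      then show False using x by simp
    qed
    then show "c = c' \<and> v = v'" using eq by simp
  qed
  moreover have "?g ` (UNIV \<times> (X \<inter> Y)) \<subseteq> X"
    using x sub by (auto intro!: V4.subspace_add V4.subspace_scale)
  ultimately have "card (UNIV \<times> (X \<inter> Y) :: (f4 \<times> v4) set) \<le> card X"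
    by (metis card_inj_on_le finite)
  then show ?thesis using X by (simp add: plane_def card_cartesian_product card_UNIV_f4)
qed

text \<open>\<open>Q\<close> can replace a unit vector at whose coordinate it is nonzero. Splitting
  off the coordinate \<open>t\<close> along \<open>Q\<close> leaves coordinates on the quotient by
  \<open>Q\<close>.\<close>

lemma extend_to_basis:
  assumes "Q \<noteq> 0"
  obtains u v w where "bij (\<lambda>(t, p). t \<cdot> Q + comb3 u v w p)"
proof -
  obtain q0 q1 q2 q3 where Q: "Q = (q0, q1, q2, q3)" by (cases Q)
  define e0 e1 e2 e3 :: v4 where "e0 = (1, 0, 0, 0)" and "e1 = (0, 1, 0, 0)"
    and "e2 = (0, 0, 1, 0)" and "e3 = (0, 0, 0, 1)"
  note e = e0_def e1_def e2_def e3_def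
  have bijI: "bij g" if "inj g" for g :: "f4 \<times> f4 \<times> f4 \<times> f4 \<Rightarrow> v4"
    unfolding bij_def using that finite_UNIV_inj_surj [OF _ that] by simp
  consider "q0 \<noteq> 0" | "q1 \<noteq> 0" | "q2 \<noteq> 0" | "q3 \<noteq> 0"
    using assms by (auto simp: Q zero_prod_def)
  then show thesis
  proof cases
    case 1
    then have "inj (\<lambda>(t, p). t \<cdot> Q + comb3 e1 e2 e3 p)"
      by (auto simp: inj_def Q e comb3_def)
    then show thesis using that bijI by blast
  next
    case 2
    then have "inj (\<lambda>(t, p). t \<cdot> Q + comb3 e0 e2 e3 p)"
      by (auto simp: inj_def Q e comb3_def)
    then show thesis using that bijI by blast
  next
    case 3
    then have "inj (\<lambda>(t, p). t \<cdot> Q + comb3 e0 e1 e3 p)"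
      by (auto simp: inj_def Q e comb3_def)
    then show thesis using that bijI by blast
  next
    case 4
    then have "inj (\<lambda>(t, p). t \<cdot> Q + comb3 e0 e1 e2 p)"
      by (auto simp: inj_def Q e comb3_def)
    then show thesis using that bijI by blast
  qed
qed

text \<open>The values at 0, 1, \<open>Fa\<close>, \<open>Fb\<close> of a nowhere zero function on
  \<open>f4\<close> orthogonal to 1 and to the identity. The two equations express \<open>q\<close>
  and \<open>p\<close> through \<open>r\<close> and \<open>s\<close>, which leaves finitely many
  cases.\<close>

lemma f4_nonzero_const:
  fixes p q r s :: f4
  assumes "p \<noteq> 0" "q \<noteq> 0" "r \<noteq> 0" "s \<noteq> 0"
    and "p + q + r + s = 0" and "q + Fa * r + Fb * s = 0"
  shows "q = p" "r = p" "s = p"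
proof -
  have "q = Fa * r + Fb * s"
    using assms(6) by (metis add.assoc eq_neg_iff_add_eq_0 uminus_f4_def)
  moreover have "p = q + r + s"
    using assms(5) by (metis add.assoc eq_neg_iff_add_eq_0 uminus_f4_def)
  ultimately have "q = p \<and> r = p \<and> s = p"
    using assms(1-4) by (cases r; cases s) (simp_all add: zero_f4_def)
  then show "q = p" "r = p" "s = p" by simp_all
qed

section \<open>Functions with the counting properties of a quartic form\<close>

text \<open>Scaling is linear because c^4 = c on F_4. Counts here are of vectors, three for each
  projective point.\<close>

locale quartic_function =
  fixes f :: "v4 \<Rightarrow> f4"
  assumes homogeneous: "f (c \<cdot> x) = c * f x"
    and no_line: "indep2 x y \<Longrightarrow> \<exists>a b. f (a \<cdot> x + b \<cdot> y) \<noteq> 0"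
    and affine_orthogonal:
      "(\<Sum>(a, b)\<in>UNIV. f (a \<cdot> x + b \<cdot> y + z) * (k + l * a + m * b)) = 0"
begin

lemma f_0: "f 0 = 0"
  using homogeneous [of 0 0] by simp

text \<open>Suppose there are at most 21 vectors, that is seven points. Five lie on the line, and
  orthogonality to affine functions removes the at most two others. On the line itself orthogonality
  then makes \<open>f\<close> constant along affine lines, against homogeneity.\<close>

lemma no_full_line:
  assumes X: "plane X" and xy: "x \<in> X" "y \<in> X" "indep2 x y"
    and full: "\<And>a b. f (a \<cdot> x + b \<cdot> y) = 0 \<Longrightarrow> a = 0 \<and> b = 0"
  shows "21 < card {v \<in> X. f v \<noteq> 0}"
proof (rule ccontr)
  assume "\<not> ?thesis"
  then have small: "card {v \<in> X. f v \<noteq> 0} \<le> 21" by simp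
  obtain z where z: "bij_betw (comb3 x y z) UNIV X"
    using extend_to_plane_basis [OF X xy] by blast
  \<comment> \<open>With the line of \<open>x\<close> and \<open>y\<close> at infinity,
    \<open>G\<close> lies in the remaining affine plane. The line supplies 15 vectors and each
    element of \<open>G\<close> three, so 15 + 3 * \<open>card G\<close> \<le> 21.\<close>
  define G where "G = {(a, b). f (a \<cdot> x + b \<cdot> y + z) \<noteq> 0}"
  let ?L = "(\<lambda>(a, b). (a, b, 0 :: f4)) ` (UNIV - {(0 :: f4, 0 :: f4)})"
  let ?M = "(\<lambda>(c, a, b). (c * a, c * b, c)) ` ((UNIV - {0 :: f4}) \<times> G)"
  have "card (?L \<union> ?M) = card ?L + card ?M"
    by (rule card_Un_disjoint) auto
  also have "card ?L = 15"
    by (subst card_image) (auto simp: inj_on_def card_Diff_subset card_UNIV_f4 simp flip: UNIV_Times_UNIV)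
  also have "card ?M = 3 * card G"
    by (subst card_image) (auto simp: inj_on_def card_Diff_subset card_UNIV_f4 card_cartesian_product)
  finally have card_LM: "card (?L \<union> ?M) = 15 + 3 * card G" .
  have "f (comb3 x y z p) \<noteq> 0" if "p \<in> ?L \<union> ?M" for p
  proof -
    have "f ((c * a) \<cdot> x + (c * b) \<cdot> y + c \<cdot> z) \<noteq> 0" if "(a, b) \<in> G" "c \<noteq> 0" for a b c
      using that homogeneous [of c "a \<cdot> x + b \<cdot> y + z"] by (simp add: G_def V4.scale_right_distrib)
    then show ?thesis using that by (auto simp: comb3_def dest: full)
  qed
  then have "comb3 x y z ` (?L \<union> ?M) \<subseteq> {v \<in> X. f v \<noteq> 0}"
    using bij_betwE [OF z] by blast
  then have "card (comb3 x y z ` (?L \<union> ?M)) \<le> 21"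
    using small card_mono by (meson finite order_trans)
  moreover have "card (comb3 x y z ` (?L \<union> ?M)) = card (?L \<union> ?M)"
    using z by (intro card_image) (auto simp: bij_betw_def inj_on_def)
  ultimately have card_G: "card G \<le> 2" using card_LM by simp
  define g where "g = (\<lambda>(a, b). f (a \<cdot> x + b \<cdot> y + z))"
  have orth: "(\<Sum>p\<in>G. g p * (k + l * fst p + m * snd p)) = 0" for k l m
  proof -
    have "(\<Sum>p\<in>G. g p * (k + l * fst p + m * snd p)) = (\<Sum>p\<in>UNIV. g p * (k + l * fst p + m * snd p))"
      by (rule sum.mono_neutral_left) (auto simp: G_def g_def)
    then show ?thesis using affine_orthogonal [of x y z k l m] by (simp add: g_def case_prod_unfold)
  qed
  have gG: "g p \<noteq> 0" if "p \<in> G" for p using that by (auto simp: G_def g_def)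
  \<comment> \<open>A single point contradicts orthogonality to 1; for two points, take an affine
    function vanishing at just one of them.\<close>
  have "G = {}"
  proof (rule ccontr)
    assume "G \<noteq> {}"
    then have "card G \<noteq> 0" by simp
    then consider "card G = 1" | "card G = 2" using card_G by linarith
    then show False
    proof cases
      case 1
      then obtain p where "G = {p}" by (auto simp: card_1_singleton_iff)
      then show False using orth [of 1 0 0] gG by simp
    next
      case 2
      then obtain p q where pq: "G = {p, q}" "p \<noteq> q" by (auto simp: card_2_iff)
      then have "fst p \<noteq> fst q \<or> snd p \<noteq> snd q" by (simp add: prod_eq_iff)
      then show False
        using orth [of "- fst q" 1 0] orth [of "- snd q" 0 1] gG [of p] pq by auto
    qed
  qed
  then have off: "f (a \<cdot> x + b \<cdot> y + z) = 0" for a b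
    by (auto simp: G_def)
  have off': "f (a \<cdot> x + b \<cdot> y + c \<cdot> z) = 0" if "c \<noteq> 0" for a b c
  proof -
    have "f (a \<cdot> x + b \<cdot> y + c \<cdot> z) = f (c \<cdot> ((a / c) \<cdot> x + (b / c) \<cdot> y + z))"
      using that by (simp add: V4.scale_right_distrib)
    also have "\<dots> = 0" using off homogeneous by simp
    finally show ?thesis .
  qed
  \<comment> \<open>Only \<open>c = 0\<close> contributes to the sum over the affine plane through
    \<open>x'\<close> in the directions \<open>y'\<close> and \<open>z\<close>, so orthogonality
    descends to an affine line.\<close>
  have line: "(\<Sum>b\<in>UNIV. f (x' + b \<cdot> y') * (k + l * b)) = 0"
    if off_line: "\<And>b c. c \<noteq> 0 \<Longrightarrow> f (x' + b \<cdot> y' + c \<cdot> z) = 0" for x' y' k l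
  proof -
    have "0 = (\<Sum>b\<in>UNIV. \<Sum>c\<in>UNIV. f (b \<cdot> y' + c \<cdot> z + x') * (k + l * b + 0 * c))"
      using affine_orthogonal [of y' z x' k l 0] by (simp add: sum.cartesian_product)
    also have "\<dots> = (\<Sum>b\<in>UNIV. \<Sum>c\<in>(UNIV :: f4 set). if c = 0 then f (x' + b \<cdot> y') * (k + l * b) else 0)"
    proof (rule sum.cong [OF refl], rule sum.cong [OF refl])
      fix b c
      have swap: "b \<cdot> y' + c \<cdot> z + x' = x' + b \<cdot> y' + c \<cdot> z" by (simp add: add_ac)
      show "f (b \<cdot> y' + c \<cdot> z + x') * (k + l * b + 0 * c)
          = (if c = 0 then f (x' + b \<cdot> y') * (k + l * b) else 0)"
        unfolding swap using off_line [of c b] by simp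
    qed
    finally show ?thesis by simp
  qed
  have const: "f (x' + 1 \<cdot> y') = f x'" "f (x' + Fb \<cdot> y') = f x'" "f (x' + Fa \<cdot> y') = f x'"
    if off_line: "\<And>b c. c \<noteq> 0 \<Longrightarrow> f (x' + b \<cdot> y' + c \<cdot> z) = 0"
      and nz: "\<And>b. f (x' + b \<cdot> y') \<noteq> 0" for x' y'
  proof -
    note l = line [of x' y', OF off_line]
    have "f x' + f (x' + 1 \<cdot> y') + f (x' + Fa \<cdot> y') + f (x' + Fb \<cdot> y') = 0"
      using l [of 1 0] by (simp add: sum_f4)
    moreover have "f (x' + 1 \<cdot> y') + Fa * f (x' + Fa \<cdot> y') + Fb * f (x' + Fb \<cdot> y') = 0"
      using l [of 0 1] by (simp add: sum_f4 mult.commute)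
    ultimately show "f (x' + 1 \<cdot> y') = f x'" "f (x' + Fb \<cdot> y') = f x'" "f (x' + Fa \<cdot> y') = f x'"
      using f4_nonzero_const [of "f x'" "f (x' + 1 \<cdot> y')" "f (x' + Fa \<cdot> y')" "f (x' + Fb \<cdot> y')"]
        nz nz [of 0] nz [of 1] by auto
  qed
  have nz: "f (x + b \<cdot> y) \<noteq> 0" "f (y + b \<cdot> x) \<noteq> 0" for b
    using full [of 1 b] full [of b 1] by (auto simp: add.commute)
  have off_x: "f (x + b \<cdot> y + c \<cdot> z) = 0" and off_y: "f (y + b \<cdot> x + c \<cdot> z) = 0" if "c \<noteq> 0" for b c
    using off' [OF that, of 1 b] off' [OF that, of b 1] by (simp_all add: add.commute [of y])
  \<comment> \<open>Constancy along \<open>x + b \<cdot> y\<close> and along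
    \<open>y + b \<cdot> x\<close> clashes with scaling by \<open>Fb\<close>, which takes
    \<open>x + Fa \<cdot> y\<close> to \<open>y + Fb \<cdot> x\<close>.\<close>
  have "Fb * f x = Fb * f (x + Fa \<cdot> y)"
    using const(3) [of x y, OF off_x nz(1)] by simp
  also have "\<dots> = f (y + Fb \<cdot> x)"
  proof -
    have "Fb * Fa = 1" by (simp add: one_f4_def)
    then have "Fb \<cdot> (x + Fa \<cdot> y) = y + Fb \<cdot> x" by (simp add: V4.scale_right_distrib add.commute)
    then show ?thesis using homogeneous [of Fb "x + Fa \<cdot> y"] by simp
  qed
  also have "\<dots> = f (y + 1 \<cdot> x)"
    using const(1,2) [of y x, OF off_y nz(2)] by simp
  also have "\<dots> = f (x + 1 \<cdot> y)" by (simp add: add.commute)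
  also have "\<dots> = f x" by (rule const(1) [of x y, OF off_x nz(1)])
  finally have "Fb * f x = f x" .
  moreover have "f x \<noteq> 0" using nz(1) [of 0] by simp
  ultimately show False by (cases "f x") (simp_all add: zero_f4_def)
qed

text \<open>In coordinates the nonzero points of \<open>X\<close> form a set of at most seven points
  in \<open>PG\<close>. It meets every line by \<open>no_line\<close> and contains none by
  \<open>no_full_line\<close>, so \<open>blocking_set_card_7\<close> applies.\<close>

lemma plane_section:
  assumes X: "plane X" and small: "card {v \<in> X. f v \<noteq> 0} \<le> 21"
    and xy: "x \<in> X" "y \<in> X" "indep2 x y" and fx: "f x = 0"
  shows "card {v \<in> X. f v \<noteq> 0} = 21" and "card {t. f (t \<cdot> x + y) \<noteq> 0} \<in> {1, 3}"
proof -
  have "indep2 y x"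
    using xy(3) unfolding indep2_def by (metis add.commute)
  \<comment> \<open>With \<open>y\<close> listed first, the points \<open>t \<cdot> x + y\<close>
    have the normalised coordinates (1, t, 0) and lie on the line (0, 0, 1).\<close>
  then obtain z where z: "bij_betw (comb3 y x z) UNIV X"
    using extend_to_plane_basis [OF X xy(2,1)] by blast
  let ?A = "comb3 y x z"
  have injA: "?A p = ?A q \<longleftrightarrow> p = q" for p q
    using z by (simp add: bij_betw_def inj_eq)
  have AX: "?A p \<in> X" for p
    using z by (auto simp: bij_betw_def)
  define T where "T = {p \<in> PG. f (?A p) \<noteq> 0}"
  have "card {v \<in> X. f v \<noteq> 0} = card {p. f (?A p) \<noteq> 0}"
  proof -
    have "{v \<in> X. f v \<noteq> 0} = ?A ` {p. f (?A p) \<noteq> 0}"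
      using z by (auto simp: bij_betw_def)
    moreover have "inj_on ?A {p. f (?A p) \<noteq> 0}"
      by (auto simp: inj_on_def injA)
    ultimately show ?thesis by (simp only: card_image)
  qed
  also have "\<dots> = (\<Sum>p\<in>UNIV. of_bool (f (?A p) \<noteq> 0))"
    by simp
  also have "\<dots> = 3 * (\<Sum>p\<in>PG. of_bool (f (?A p) \<noteq> 0))"
    by (subst sum_invariant) (simp_all add: comb3_scale comb3_0 homogeneous f_0)
  also have "(\<Sum>p\<in>PG. of_bool (f (?A p) \<noteq> 0)) = card T"
    by (simp add: T_def Int_def)
  finally have card_T: "card {v \<in> X. f v \<noteq> 0} = 3 * card T" .
  have T_scale: "f (?A (scale3 c p)) \<noteq> 0 \<longleftrightarrow> p \<in> T" if "c \<noteq> 0" "p \<in> PG" for c p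
    using that by (simp add: T_def comb3_scale homogeneous)
  \<comment> \<open>A line of \<open>PG\<close> thereby corresponds to the span of two independent
    vectors, as required by \<open>no_line\<close> and \<open>no_full_line\<close>.\<close>
  have two_points: "\<exists>p q. p \<in> polar h \<and> q \<in> polar h \<and> indep2 (?A p) (?A q)" if "h \<in> PG" for h
  proof -
    have "\<not> card (polar h) \<le> Suc 0" using card_polar [OF that] by simp
    then obtain p q where pq: "p \<in> polar h" "q \<in> polar h" "p \<noteq> q"
      unfolding card_le_Suc0_iff_eq [OF finite] by blast
    have "a = 0 \<and> b = 0" if "a \<cdot> ?A p + b \<cdot> ?A q = 0" for a b
    proof -
      have "?A (scale3 a p + scale3 b q) = ?A 0"
        using that by (simp add: comb3_add comb3_scale comb3_0)
      then have "scale3 a p + scale3 b q = 0" by (simp only: injA)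
      then have eq: "scale3 a p = scale3 (- b) q"
        by (simp only: V3.scale_minus_left eq_neg_iff_add_eq_0)
      have PG: "p \<in> PG" "q \<in> PG" using pq polarD by blast+
      then have "a = 0" using scale3_PG_inject [OF PG eq] pq by blast
      with eq have "scale3 (- b) q = 0" by (simp only: V3.scale_zero_left)
      then show ?thesis using PG_nonzero [OF PG(2)] \<open>a = 0\<close> by (simp only: V3.scale_eq_0_iff) simp
    qed
    then have "indep2 (?A p) (?A q)" unfolding indep2_def by blast
    then show ?thesis using pq by blast
  qed
  have T7: "card T \<le> 7" using small card_T by simp
  have blocking: "T \<inter> polar h \<noteq> {}" if h: "h \<in> PG" for h
  proof -
    obtain p q where pq: "p \<in> polar h" "q \<in> polar h" "indep2 (?A p) (?A q)"
      using two_points [OF h] by blast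
    obtain a b where "f (a \<cdot> ?A p + b \<cdot> ?A q) \<noteq> 0" using no_line [OF pq(3)] by blast
    then have nz: "f (?A (scale3 a p + scale3 b q)) \<noteq> 0" by (simp add: comb3_add comb3_scale)
    then have "scale3 a p + scale3 b q \<noteq> 0" using comb3_0 f_0 by metis
    then obtain c r where r: "c \<noteq> 0" "r \<in> PG" "scale3 a p + scale3 b q = scale3 c r"
      by (rule scale3_PG)
    have "c * dot h r = dot h (scale3 a p + scale3 b q)" by (simp only: r dot_scale)
    also have "\<dots> = 0" using pq by (simp add: dot_add dot_scale polar_def)
    finally have "r \<in> polar h" using r by (simp add: polar_def)
    moreover have "r \<in> T" using nz r T_scale by simp
    ultimately show ?thesis by blast
  qed
  have no_line': "\<not> polar h \<subseteq> T" if h: "h \<in> PG" for h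
  proof
    assume sub: "polar h \<subseteq> T"
    obtain p q where pq: "p \<in> polar h" "q \<in> polar h" "indep2 (?A p) (?A q)"
      using two_points [OF h] by blast
    have "a = 0 \<and> b = 0" if zero: "f (a \<cdot> ?A p + b \<cdot> ?A q) = 0" for a b
    proof (rule ccontr)
      assume "\<not> ?thesis"
      then have "a \<cdot> ?A p + b \<cdot> ?A q \<noteq> 0" using pq(3) by (auto simp: indep2_def)
      then have "scale3 a p + scale3 b q \<noteq> 0" using comb3_0 by (metis comb3_add comb3_scale)
      then obtain c r where r: "c \<noteq> 0" "r \<in> PG" "scale3 a p + scale3 b q = scale3 c r"
        by (rule scale3_PG)
      have "c * dot h r = dot h (scale3 a p + scale3 b q)" by (simp only: r dot_scale)
      also have "\<dots> = 0" using pq by (simp add: dot_add dot_scale polar_def)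
      finally have "r \<in> T" using r sub by (auto simp: polar_def)
      then have "f (?A (scale3 a p + scale3 b q)) \<noteq> 0" using r T_scale by simp
      then show False using zero by (simp add: comb3_add comb3_scale)
    qed
    from no_full_line [OF X AX AX pq(3) this] show False using small by simp
  qed
  note B = blocking_set_card_7 [of T, OF _ T7 blocking no_line']
  have TPG: "T \<subseteq> PG" by (auto simp: T_def)
  show "card {v \<in> X. f v \<noteq> 0} = 21" using B(1) [OF TPG] card_T by simp
  \<comment> \<open>The remaining point (0, 1, 0) of this line is \<open>x\<close>, where
    \<open>f\<close> vanishes.\<close>
  have "T \<inter> polar (0, 0, 1) = (\<lambda>t. (1, t, 0)) ` {t. f (t \<cdot> x + y) \<noteq> 0}"
    using fx by (auto simp: T_def polar_def PG_def comb3_def add.commute)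
  moreover have "card ((\<lambda>t. (1 :: f4, t, 0 :: f4)) ` {t. f (t \<cdot> x + y) \<noteq> 0}) = card {t. f (t \<cdot> x + y) \<noteq> 0}"
    by (rule card_image) (auto simp: inj_on_def)
  moreover have "(0, 0, 1) \<in> PG" by (simp add: PG_def)
  ultimately show "card {t. f (t \<cdot> x + y) \<noteq> 0} \<in> {1, 3}"
    using B(2) [OF TPG, of "(0, 0, 1)"] by simp
qed

text \<open>Projection from \<open>Q\<close>: its 21 lines form a copy of \<open>PG\<close>, and 99
  vectors are 33 points. Discounting one point per line leaves weight at most 12, so
  \<open>double_blocking_line\<close> gives a plane whose five lines through \<open>Q\<close> carry
  at least three nonzero points each, hence 15 points or 45 vectors.\<close>

lemma poor_plane:
  assumes Q: "Q \<noteq> 0" "f Q = 0" and small: "card {v. f v \<noteq> 0} \<le> 99"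
  obtains X where "plane X" "Q \<in> X" "45 \<le> card {v \<in> X. f v \<noteq> 0}"
proof -
  obtain u v w where bij: "bij (\<lambda>(t, p). t \<cdot> Q + comb3 u v w p)"
    using extend_to_basis [OF Q(1)] by blast
  let ?A = "comb3 u v w"
  let ?g = "\<lambda>(t, p). t \<cdot> Q + ?A p"
  have inj: "t \<cdot> Q + ?A p = t' \<cdot> Q + ?A p' \<longleftrightarrow> t = t' \<and> p = p'" for t p t' p'
    using injD [OF bij_is_inj [OF bij], of "(t, p)" "(t', p')"] by auto
  \<comment> \<open>Since \<open>f Q = 0\<close>, this counts all nonzero points on the line joining
    \<open>Q\<close> to \<open>?A p\<close>.\<close>
  define n where "n p = card {t. f (t \<cdot> Q + ?A p) \<noteq> 0}" for p
  have n_scale: "n (scale3 c p) = n p" if c: "c \<noteq> 0" for c p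
  proof -
    have "bij_betw (\<lambda>t. c * t) {t. f (t \<cdot> Q + ?A p) \<noteq> 0} {t. f (t \<cdot> Q + ?A (scale3 c p)) \<noteq> 0}"
    proof (rule bij_betw_byWitness [where f' = "\<lambda>t. t / c"])
      show "(\<lambda>t. c * t) ` {t. f (t \<cdot> Q + ?A p) \<noteq> 0} \<subseteq> {t. f (t \<cdot> Q + ?A (scale3 c p)) \<noteq> 0}"
      proof (rule image_subsetI)
        fix t assume "t \<in> {t. f (t \<cdot> Q + ?A p) \<noteq> 0}"
        then show "c * t \<in> {t. f (t \<cdot> Q + ?A (scale3 c p)) \<noteq> 0}"
          using c homogeneous [of c "t \<cdot> Q + ?A p"] by (simp add: comb3_scale V4.scale_right_distrib)
      qed
      show "(\<lambda>t. t / c) ` {t. f (t \<cdot> Q + ?A (scale3 c p)) \<noteq> 0} \<subseteq> {t. f (t \<cdot> Q + ?A p) \<noteq> 0}"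
      proof (rule image_subsetI)
        fix t assume "t \<in> {t. f (t \<cdot> Q + ?A (scale3 c p)) \<noteq> 0}"
        then show "t / c \<in> {t. f (t \<cdot> Q + ?A p) \<noteq> 0}"
          using c homogeneous [of c "(t / c) \<cdot> Q + ?A p"] by (simp add: comb3_scale V4.scale_right_distrib)
      qed
    qed (use c in auto)
    then show ?thesis by (simp add: n_def bij_betw_same_card)
  qed
  have n_0: "n 0 = 0"
    using Q by (simp add: n_def comb3_0 homogeneous)
  \<comment> \<open>The set lies over \<open>R\<close> under projection from \<open>Q\<close>. It
    will be the whole space for \<open>R = UNIV\<close> and a plane through \<open>Q\<close> when
    \<open>R\<close> is the kernel of \<open>dot h\<close>.\<close>
  have card_n: "card {v \<in> (\<lambda>(t, p). t \<cdot> Q + ?A p) ` (UNIV \<times> R). f v \<noteq> 0} = (\<Sum>p\<in>R. n p)" for R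
  proof -
    have "{v \<in> ?g ` (UNIV \<times> R). f v \<noteq> 0} = (\<lambda>(p, t). t \<cdot> Q + ?A p) ` (SIGMA p:R. {t. f (t \<cdot> Q + ?A p) \<noteq> 0})"
      (is "?l = ?r")
    proof (intro equalityI subsetI)
      fix y assume "y \<in> ?l"
      then obtain x where "x \<in> UNIV \<times> R" "y = ?g x" "f y \<noteq> 0" by blast
      then show "y \<in> ?r"
        by (intro image_eqI [of _ _ "(snd x, fst x)"]) (simp_all add: case_prod_unfold mem_Times_iff)
    next
      fix y assume "y \<in> ?r"
      then obtain x where "x \<in> (SIGMA p:R. {t. f (t \<cdot> Q + ?A p) \<noteq> 0})" "y = (\<lambda>(p, t). t \<cdot> Q + ?A p) x"
        by blast
      then have "fst x \<in> R" "y = ?g (snd x, fst x)" "f y \<noteq> 0"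
        by (simp_all add: case_prod_unfold mem_Sigma_iff [of "fst x" "snd x", simplified])
      then show "y \<in> ?l" by blast
    qed
    moreover have "inj_on (\<lambda>(p, t). t \<cdot> Q + ?A p) (SIGMA p:R. {t. f (t \<cdot> Q + ?A p) \<noteq> 0})"
      by (auto simp: inj_on_def inj)
    ultimately show ?thesis by (simp add: card_image card_SigmaI n_def)
  qed
  have n_pos: "1 \<le> n p" and indep: "indep2 Q (?A p)" if p: "p \<in> PG" for p
  proof -
    have p0: "p \<noteq> 0" using p by (rule PG_nonzero)
    show ind: "indep2 Q (?A p)"
      unfolding indep2_def
    proof (intro allI impI)
      fix a b assume "a \<cdot> Q + b \<cdot> ?A p = 0"
      then have "a \<cdot> Q + ?A (scale3 b p) = 0 \<cdot> Q + ?A 0" by (simp add: comb3_scale comb3_0)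
      then have "a = 0" "scale3 b p = 0" by (simp_all only: inj)
      then show "a = 0 \<and> b = 0" using p0 by (simp only: V3.scale_eq_0_iff) simp
    qed
    obtain a b where ab: "f (a \<cdot> Q + b \<cdot> ?A p) \<noteq> 0" using no_line [OF ind] by blast
    have "b \<noteq> 0" using ab Q by (auto simp: homogeneous)
    then have "f ((a / b) \<cdot> Q + ?A p) \<noteq> 0"
      using ab homogeneous [of b "(a / b) \<cdot> Q + ?A p"] by (auto simp: V4.scale_right_distrib)
    then have "{t. f (t \<cdot> Q + ?A p) \<noteq> 0} \<noteq> {}" by blast
    then show "1 \<le> n p" by (simp add: n_def Suc_le_eq card_gt_0_iff)
  qed
  define X where "X h = ?g ` (UNIV \<times> {r. dot h r = 0})" for h
  have card_X: "card {v \<in> X h. f v \<noteq> 0} = 3 * sum n (polar h)" for h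
  proof -
    have "card {v \<in> X h. f v \<noteq> 0} = (\<Sum>p\<in>{r. dot h r = 0}. n p)"
      by (simp only: X_def card_n)
    also have "\<dots> = (\<Sum>p\<in>UNIV. if dot h p = 0 then n p else 0)"
      using sum.inter_filter [of UNIV n "\<lambda>r. dot h r = 0"] by simp
    also have "\<dots> = 3 * (\<Sum>p\<in>PG. if dot h p = 0 then n p else 0)"
      by (subst sum_invariant) (simp_all add: n_0 n_scale dot_scale)
    also have "(\<Sum>p\<in>PG. if dot h p = 0 then n p else 0) = sum n (polar h)"
      unfolding polar_def by (simp only: sum.inter_filter finite_PG)
    finally show ?thesis .
  qed
  have X_I: "t \<cdot> Q + ?A p \<in> X h" if "dot h p = 0" for h p t
    unfolding X_def by (rule image_eqI [of _ _ "(t, p)"]) (use that in simp_all)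
  have X_E: "\<exists>t p. dot h p = 0 \<and> x = t \<cdot> Q + ?A p" if x: "x \<in> X h" for x h
  proof -
    obtain q where "x = ?g q" "q \<in> UNIV \<times> {r. dot h r = 0}"
      using x unfolding X_def by (rule imageE)
    then have "dot h (snd q) = 0 \<and> x = fst q \<cdot> Q + ?A (snd q)"
      by (simp add: case_prod_unfold mem_Times_iff)
    then show ?thesis by blast
  qed
  have plane_X: "plane (X h)" if h: "h \<in> PG" for h
    unfolding plane_def
  proof
    show "V4.subspace (X h)"
    proof (rule V4.subspaceI)
      show "0 \<in> X h"
        using X_I [of h 0 0] by (simp add: comb3_0 dot_0)
    next
      fix x y assume "x \<in> X h" "y \<in> X h"
      then obtain t p t' p' where *: "dot h p = 0" "x = t \<cdot> Q + ?A p" "dot h p' = 0" "y = t' \<cdot> Q + ?A p'"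
        using X_E by meson
      then have "x + y = (t + t') \<cdot> Q + ?A (p + p')"
        by (simp add: comb3_add V4.scale_left_distrib algebra_simps)
      then show "x + y \<in> X h"
        using X_I [of h "p + p'" "t + t'"] * by (simp add: dot_add)
    next
      fix c x assume "x \<in> X h"
      then obtain t p where *: "dot h p = 0" "x = t \<cdot> Q + ?A p"
        using X_E by blast
      then have "c \<cdot> x = (c * t) \<cdot> Q + ?A (scale3 c p)"
        by (simp add: comb3_scale V4.scale_right_distrib)
      then show "c \<cdot> x \<in> X h"
        using X_I [of h "scale3 c p" "c * t"] * by (simp add: dot_scale)
    qed
    have "card {r. dot h r = 0} = (\<Sum>p\<in>UNIV. of_bool (dot h p = 0))"
      by simp
    also have "\<dots> = of_bool (dot h 0 = 0) + 3 * (\<Sum>p\<in>PG. of_bool (dot h p = 0))"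
      by (rule sum_invariant) (simp add: dot_scale)
    also have "(\<Sum>p\<in>PG. of_bool (dot h p = 0)) = card (polar h)"
      by (simp add: polar_def Int_def)
    finally have "card {r. dot h r = 0} = 16" using card_polar [OF h] by (simp add: dot_0)
    moreover have "card (X h) = card (UNIV \<times> {r. dot h r = 0} :: (f4 \<times> _) set)"
      unfolding X_def by (rule card_image) (auto simp: inj_on_def inj)
    ultimately show "card (X h) = 64" by (simp add: card_cartesian_product card_UNIV_f4)
  qed
  have X_mem: "?A p \<in> X h" if "p \<in> polar h" for p h
    using that X_I [of h p 0] by (simp add: polar_def)
  have QX: "Q \<in> X h" for h
    using X_I [of h 0 1] by (simp add: comb3_0 dot_0)
  \<comment> \<open>The truncated difference is exact on \<open>PG\<close> by
    \<open>n_pos\<close>.\<close>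
  define e where "e p = n p - 1" for p
  have n_e: "n p = e p + 1" if "p \<in> PG" for p
    using n_pos [OF that] by (simp add: e_def)
  have sum_e: "sum n (polar h) = sum e (polar h) + 5" if "h \<in> PG" for h
  proof -
    have "sum n (polar h) = (\<Sum>p\<in>polar h. e p + 1)"
      by (rule sum.cong [OF refl]) (rule n_e [OF polarD])
    then show ?thesis by (simp only: sum.distrib) (simp add: card_polar that)
  qed
  have E12: "sum e PG \<le> 12"
  proof -
    have "card {v. f v \<noteq> 0} = sum n UNIV"
      using card_n [of UNIV] bij by (simp add: bij_def)
    also have "\<dots> = 3 * sum n PG"
      by (simp add: sum_invariant n_0 n_scale)
    also have "sum n PG = (\<Sum>p\<in>PG. e p + 1)"
      by (rule sum.cong [OF refl]) (rule n_e)
    also have "\<dots> = sum e PG + 21"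
      by (simp only: sum.distrib) (simp add: card_PG)
    finally show ?thesis using small by simp
  qed
  \<comment> \<open>Seven nonzero points on five lines mean weight 7 - 5 = 2, and \<open>n p\<close>
    in {1, 3} means \<open>e p\<close> in {0, 2}, as \<open>double_blocking_line\<close>
    demands.\<close>
  have sect: "7 \<le> sum n (polar h) \<and> (sum n (polar h) = 7 \<longrightarrow> (\<forall>p\<in>polar h. n p \<in> {1, 3}))"
    if h: "h \<in> PG" for h
  proof (cases "7 < sum n (polar h)")
    case False
    then have small: "card {v \<in> X h. f v \<noteq> 0} \<le> 21" by (simp add: card_X)
    have "card {v \<in> X h. f v \<noteq> 0} = 21 \<and> n p \<in> {1, 3}" if p: "p \<in> polar h" for p
    proof -
      have "?A p \<in> X h" using p by (rule X_mem)
      moreover have "p \<in> PG" using p by (rule polarD)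
      ultimately show ?thesis
        using plane_section [OF plane_X [OF h] small QX, of "?A p"] indep Q by (simp add: n_def)
    qed
    moreover have "polar h \<noteq> {}" using card_polar [OF h] by auto
    ultimately show ?thesis using card_X [of h] by auto
  qed auto
  have ge2: "2 \<le> sum e (polar h)" if "h \<in> PG" for h
    using sect [OF that] sum_e [OF that] by simp
  have eq2: "e p \<in> {0, 2}" if "h \<in> PG" "sum e (polar h) = 2" "p \<in> polar h" for h p
  proof -
    have "n p \<in> {1, 3}" using sect [OF that(1)] sum_e [OF that(1)] that(2,3) by simp
    then show ?thesis by (auto simp: e_def)
  qed
  have "\<exists>h\<in>PG. \<forall>p\<in>polar h. 2 \<le> e p"
    using E12 ge2 eq2 by (rule double_blocking_line)
  then obtain h where h: "h \<in> PG" "\<forall>p\<in>polar h. 2 \<le> e p"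
    by blast
  have "(\<Sum>p\<in>polar h. 2) \<le> sum e (polar h)" by (rule sum_mono) (use h in blast)
  then have "45 \<le> card {v \<in> X h. f v \<noteq> 0}"
    using card_polar [OF h(1)] by (simp add: card_X sum_e [OF h(1)])
  then show thesis using that plane_X [OF h(1)] QX by blast
qed

section \<open>Covering the zeros by planes with few of them\<close>

text \<open>The bound is 3 * 52 - 1. With 156 zeros only 99 nonzero values remain; six planes with
  at least 45 of these each and at most 15 in common pairwise contradict a second moment
  estimate.\<close>

lemma card_zeros:
  "card {v. v \<noteq> 0 \<and> f v = 0} \<le> 155"
proof (rule ccontr)
  assume "\<not> ?thesis"
  then have many: "156 \<le> card {v. v \<noteq> 0 \<and> f v = 0}" by simp
  let ?B = "{v. f v \<noteq> 0}" and ?S = "{v. v \<noteq> 0 \<and> f v = 0}"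
  have "card (?B \<union> ?S) = card ?B + card ?S"
    by (rule card_Un_disjoint) auto
  moreover have "?B \<union> ?S = UNIV - {0}" using f_0 by auto
  moreover have "card (UNIV - {0 :: v4}) = 255"
    using card_Diff_singleton [of 0 "UNIV :: v4 set"] by (simp add: card_UNIV_v4)
  ultimately have B: "card ?B \<le> 99" using many by simp
  define \<P> where "\<P> = {X. plane X \<and> 45 \<le> card (X \<inter> ?B)}"
  have "?S \<subseteq> (\<Union>X\<in>\<P>. X \<inter> ?S)"
  proof
    fix Q assume Q: "Q \<in> ?S"
    then obtain X where "plane X" "Q \<in> X" "45 \<le> card {v \<in> X. f v \<noteq> 0}"
      using poor_plane [of Q] B by auto
    moreover have "{v \<in> X. f v \<noteq> 0} = X \<inter> ?B" by auto
    ultimately show "Q \<in> (\<Union>X\<in>\<P>. X \<inter> ?S)" using Q by (auto simp: \<P>_def)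
  qed
  then have "card ?S \<le> card (\<Union>X\<in>\<P>. X \<inter> ?S)" by (rule card_mono [rotated]) simp
  also have "\<dots> \<le> (\<Sum>X\<in>\<P>. card (X \<inter> ?S))" by (rule card_UN_le) simp
  \<comment> \<open>Of the 63 nonzero vectors of such a plane at least 45 are not zeros of
    \<open>f\<close>.\<close>
  also have "\<dots> \<le> (\<Sum>X\<in>\<P>. 18)"
  proof (rule sum_mono)
    fix X assume "X \<in> \<P>"
    then have X: "plane X" "45 \<le> card (X \<inter> ?B)" by (auto simp: \<P>_def)
    then have "0 \<in> X" "card X = 64" by (auto simp: plane_def V4.subspace_0)
    have "card (X \<inter> ?B \<union> X \<inter> ?S) = card (X \<inter> ?B) + card (X \<inter> ?S)"
      by (rule card_Un_disjoint) auto
    moreover have "X \<inter> ?B \<union> X \<inter> ?S = X - {0}" using f_0 by auto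
    moreover have "card (X - {0}) = 63" using \<open>0 \<in> X\<close> \<open>card X = 64\<close> by simp
    ultimately show "card (X \<inter> ?S) \<le> 18" using X by simp
  qed
  finally have "6 \<le> card \<P>" using many by simp
  then obtain \<S> where S: "\<S> \<subseteq> \<P>" "card \<S> = 6" by (meson obtain_subset_with_card_n)
  define r where "r v = card {X \<in> \<S>. v \<in> X}" for v
  have r_sum: "r v = (\<Sum>X\<in>\<S>. of_bool (v \<in> X))" for v
    by (simp add: r_def) (simp add: Int_def)
  have sum_r: "(\<Sum>v\<in>?B. r v) = (\<Sum>X\<in>\<S>. card (X \<inter> ?B))"
    unfolding r_sum by (subst sum.swap) (simp add: Int_commute)
  have sum_r2: "(\<Sum>v\<in>?B. r v * r v) = (\<Sum>X\<in>\<S>. \<Sum>Y\<in>\<S>. card (X \<inter> Y \<inter> ?B))"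
  proof -
    have "(\<Sum>v\<in>?B. r v * r v) = (\<Sum>v\<in>?B. \<Sum>X\<in>\<S>. \<Sum>Y\<in>\<S>. of_bool (v \<in> X \<inter> Y))"
      unfolding r_sum sum_product by (simp add: of_bool_conj)
    also have "\<dots> = (\<Sum>X\<in>\<S>. \<Sum>Y\<in>\<S>. \<Sum>v\<in>?B. of_bool (v \<in> X \<inter> Y))"
      by (subst sum.swap) (intro sum.cong refl sum.swap)
    also have "\<dots> = (\<Sum>X\<in>\<S>. \<Sum>Y\<in>\<S>. card (X \<inter> Y \<inter> ?B))"
      by (simp add: Int_commute Int_left_commute Int_def conj_commute)
    finally show ?thesis .
  qed
  have pair: "card (X \<inter> Y \<inter> ?B) \<le> 15" if "X \<in> \<S>" "Y \<in> \<S>" "X \<noteq> Y" for X Y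
  proof -
    have XY: "plane X" "plane Y" using that S by (auto simp: \<P>_def)
    then have "0 \<in> X \<inter> Y" by (auto simp: plane_def V4.subspace_0)
    then have "card (X \<inter> Y - {0}) \<le> 15" using plane_Int [OF XY that(3)] by simp
    moreover have "card (X \<inter> Y \<inter> ?B) \<le> card (X \<inter> Y - {0})"
      using f_0 by (intro card_mono) auto
    ultimately show ?thesis by simp
  qed
  \<comment> \<open>The diagonal gives \<open>card (X \<inter> ?B)\<close>, and the five other
    planes at most 5 * 15 = 75.\<close>
  have "(\<Sum>X\<in>\<S>. \<Sum>Y\<in>\<S>. card (X \<inter> Y \<inter> ?B)) \<le> (\<Sum>X\<in>\<S>. card (X \<inter> ?B) + 75)"
  proof (rule sum_mono)
    fix X assume X: "X \<in> \<S>"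
    have "(\<Sum>Y\<in>\<S>. card (X \<inter> Y \<inter> ?B)) = card (X \<inter> ?B) + (\<Sum>Y\<in>\<S> - {X}. card (X \<inter> Y \<inter> ?B))"
      using X by (simp add: sum.remove)
    also have "(\<Sum>Y\<in>\<S> - {X}. card (X \<inter> Y \<inter> ?B)) \<le> (\<Sum>Y\<in>\<S> - {X}. 15)"
      by (rule sum_mono) (use X pair in auto)
    also have "\<dots> = 75" using X S by simp
    finally show "(\<Sum>Y\<in>\<S>. card (X \<inter> Y \<inter> ?B)) \<le> card (X \<inter> ?B) + 75" by simp
  qed
  then have r2: "(\<Sum>v\<in>?B. r v * r v) \<le> (\<Sum>v\<in>?B. r v) + 450"
    using S by (simp add: sum_r sum_r2 sum.distrib)
  have "(\<Sum>X\<in>\<S>. 45) \<le> (\<Sum>X\<in>\<S>. card (X \<inter> ?B))"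
    using S by (intro sum_mono) (auto simp: \<P>_def)
  then have r1: "270 \<le> (\<Sum>v\<in>?B. r v)" using S by (simp add: sum_r)
  \<comment> \<open>The product is nonnegative at integers, and 2 and 3 enclose the ratio 270 / 99.
    With R the sum of \<open>r\<close>, the total is at most 450 - 4 * R + 6 * 99 \<le> 1044 -
    1080.\<close>
  have "0 \<le> (\<Sum>v\<in>?B. (int (r v) - 2) * (int (r v) - 3))"
  proof (rule sum_nonneg)
    fix v
    consider "r v \<le> 2" | "3 \<le> r v" by linarith
    then show "0 \<le> (int (r v) - 2) * (int (r v) - 3)"
      by cases (auto intro: mult_nonneg_nonneg mult_nonpos_nonpos)
  qed
  also have "\<dots> = (\<Sum>v\<in>?B. int (r v * r v) - 5 * int (r v) + 6)"
    by (rule sum.cong) (simp_all add: algebra_simps)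
  also have "\<dots> = int (\<Sum>v\<in>?B. r v * r v) - 5 * int (\<Sum>v\<in>?B. r v) + 6 * int (card ?B)"
    by (simp add: sum.distrib sum_subtractf flip: sum_distrib_left)
  also have "\<dots> < 0" using r1 r2 B by linarith
  finally show False by simp
qed

end

subsection \<open>Quartic forms\<close>

lemma sum_power_f4: "i \<le> 2 \<Longrightarrow> (\<Sum>a\<in>UNIV. a ^ i) = (0 :: f4)"
proof -
  assume "i \<le> 2"
  then consider "i = 0" | "i = 1" | "i = 2" by linarith
  then show ?thesis
    unfolding sum_f4 by cases (simp_all add: power2_eq_square zero_f4_def one_f4_def)
qed

text \<open>The powers of \<open>a\<close> and \<open>b\<close> are there for the induction, which
  expands one affine factor at a time. With no factors left, \<open>i + j \<le> 5\<close> forces an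
  exponent at most 2, whose power sum vanishes.\<close>

lemma sum_affine_product:
  "i + j + length fs \<le> 5 \<Longrightarrow>
    (\<Sum>a\<in>UNIV. \<Sum>b\<in>UNIV. a ^ i * b ^ j * (\<Prod>(p, q, r)\<leftarrow>fs. p * a + q * b + r)) = (0 :: f4)"
proof (induction fs arbitrary: i j)
  case Nil
  have "(\<Sum>a\<in>UNIV. \<Sum>b\<in>UNIV. a ^ i * b ^ j) = (\<Sum>a\<in>UNIV. a ^ i) * (\<Sum>b\<in>UNIV. b ^ j :: f4)"
    by (simp add: sum_product)
  moreover have "i \<le> 2 \<or> j \<le> 2" using Nil by auto
  ultimately show ?case using sum_power_f4 by auto
next
  case (Cons h fs)
  obtain p q r where h: "h = (p, q, r)" by (cases h)
  let ?P = "\<lambda>a b. \<Prod>(p, q, r)\<leftarrow>fs. p * a + q * b + r"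
  have "(\<Sum>a\<in>UNIV. \<Sum>b\<in>UNIV. a ^ i * b ^ j * (\<Prod>(p, q, r)\<leftarrow>h # fs. p * a + q * b + r))
      = (\<Sum>a\<in>UNIV. \<Sum>b\<in>UNIV. p * (a ^ Suc i * b ^ j * ?P a b) + q * (a ^ i * b ^ Suc j * ?P a b)
          + r * (a ^ i * b ^ j * ?P a b))"
    by (intro sum.cong refl) (simp add: h algebra_simps)
  also have "\<dots> = p * (\<Sum>a\<in>UNIV. \<Sum>b\<in>UNIV. a ^ Suc i * b ^ j * ?P a b)
      + q * (\<Sum>a\<in>UNIV. \<Sum>b\<in>UNIV. a ^ i * b ^ Suc j * ?P a b)
      + r * (\<Sum>a\<in>UNIV. \<Sum>b\<in>UNIV. a ^ i * b ^ j * ?P a b)"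
    by (simp only: sum.distrib sum_distrib_left)
  also have "\<dots> = 0"
    using Cons.IH [of "Suc i" j] Cons.IH [of i "Suc j"] Cons.IH [of i j] Cons.prems by simp
  finally show ?case .
qed

section \<open>Restriction of a quartic form to a line\<close>

text \<open>Listing the variables of a monomial with multiplicity turns substitution of linear forms
  into a list product, open to induction.\<close>

definition mon_list :: "(nat \<Rightarrow> nat) \<Rightarrow> nat list" where
  "mon_list m = replicate (m 0) 0 @ replicate (m 1) 1 @ replicate (m 2) 2 @ replicate (m 3) 3"

lemma prod_mon_list: "(\<Prod>i\<leftarrow>mon_list m. y i) = (\<Prod>i<4. y i ^ m i)"
  for y :: "nat \<Rightarrow> 'a :: comm_monoid_mult"
  by (simp add: mon_list_def prod_list_replicate numeral_eq_Suc mult.assoc)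

lemma length_mon_list: "length (mon_list m) = (\<Sum>i<4. m i)"
  by (simp add: mon_list_def numeral_eq_Suc)

text \<open>The coefficient of $S^k T^{n-k}$ in the product of the $n$ linear forms $pS + qT$.\<close>

fun lin_coeff :: "(f4 \<times> f4) list \<Rightarrow> nat \<Rightarrow> f4" where
  "lin_coeff [] k = (if k = 0 then 1 else 0)"
| "lin_coeff ((p, q) # fs) k = (case k of 0 \<Rightarrow> 0 | Suc k' \<Rightarrow> p * lin_coeff fs k') + q * lin_coeff fs k"

lemma lin_coeff_eq_0: "length fs < k \<Longrightarrow> lin_coeff fs k = 0"
proof (induction fs arbitrary: k)
  case (Cons h fs)
  then show ?case by (cases h; cases k) auto
qed simp

text \<open>The map \<open>\<phi>\<close> lets one expansion serve for values, as the identity, and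
  for polynomials, as \<open>mconst\<close>.\<close>

lemma prod_linear_forms:
  fixes \<phi> :: "f4 \<Rightarrow> 'a :: comm_ring_1"
  assumes add: "\<And>a b. \<phi> (a + b) = \<phi> a + \<phi> b" and mult: "\<And>a b. \<phi> (a * b) = \<phi> a * \<phi> b" and one: "\<phi> 1 = 1"
  shows "(\<Prod>(p, q)\<leftarrow>fs. \<phi> p * S + \<phi> q * T) = (\<Sum>k\<le>length fs. \<phi> (lin_coeff fs k) * S ^ k * T ^ (length fs - k))"
proof (induction fs)
  case Nil
  then show ?case by (simp add: one)
next
  case (Cons h fs)
  have zero: "\<phi> 0 = 0" using add [of 0 0] by simp
  obtain p q where h: "h = (p, q)" by (cases h)
  let ?n = "length fs" and ?c = "lin_coeff fs"
  have "(\<Sum>k\<le>Suc ?n. \<phi> (lin_coeff (h # fs) k) * S ^ k * T ^ (Suc ?n - k))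
      = (\<Sum>k\<le>Suc ?n. \<phi> (case k of 0 \<Rightarrow> 0 | Suc k' \<Rightarrow> p * ?c k') * S ^ k * T ^ (Suc ?n - k))
        + (\<Sum>k\<le>Suc ?n. \<phi> (q * ?c k) * S ^ k * T ^ (Suc ?n - k))"
    by (simp only: h lin_coeff.simps add distrib_right sum.distrib)
  also have "(\<Sum>k\<le>Suc ?n. \<phi> (case k of 0 \<Rightarrow> 0 | Suc k' \<Rightarrow> p * ?c k') * S ^ k * T ^ (Suc ?n - k))
      = (\<Sum>k\<le>?n. \<phi> p * S * (\<phi> (?c k) * S ^ k * T ^ (?n - k)))"
    unfolding sum.atMost_Suc_shift by (simp add: zero mult mult_ac)
  \<comment> \<open>The top term drops out, since \<open>fs\<close> has only \<open>?n\<close>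
    factors.\<close>
  also have "(\<Sum>k\<le>Suc ?n. \<phi> (q * ?c k) * S ^ k * T ^ (Suc ?n - k))
      = (\<Sum>k\<le>?n. \<phi> (q * ?c k) * S ^ k * T ^ (Suc ?n - k))"
    by (simp add: lin_coeff_eq_0 zero)
  also have "\<dots> = (\<Sum>k\<le>?n. \<phi> q * T * (\<phi> (?c k) * S ^ k * T ^ (?n - k)))"
    by (rule sum.cong) (simp_all add: mult mult_ac Suc_diff_le)
  finally have "(\<Sum>k\<le>Suc ?n. \<phi> (lin_coeff (h # fs) k) * S ^ k * T ^ (Suc ?n - k))
      = (\<phi> p * S + \<phi> q * T) * (\<Sum>k\<le>?n. \<phi> (?c k) * S ^ k * T ^ (?n - k))"
    by (simp only: sum_distrib_left [symmetric] distrib_right)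
  then show ?case by (simp only: h list.map prod_list.Cons case_prod_conv Cons.IH length_Cons)
qed

lemma mconst_add: "mconst (a + b) = mconst a + mconst b"
  by (simp add: mconst_def single_add)

lemma mconst_mult: "mconst (a * b) = mconst a * mconst b"
  by (simp add: mconst_def mult_single)

lemma mconst_0 [simp]: "mconst 0 = 0"
  by (simp add: mconst_def)

lemma mconst_1: "mconst 1 = 1"
  by (simp add: mconst_def)

lemma is_form_degree:
  assumes "is_form_P3 d F" "m \<in> Poly_Mapping.keys F"
  shows "(\<Sum>i<4. Poly_Mapping.lookup m i) = d"
proof -
  have "Poly_Mapping.keys m \<subseteq> {..<4}" "mon_deg m = d"
    using assms by (auto simp: is_form_P3_def atLeast0LessThan)
  moreover have "(\<Sum>i<4. Poly_Mapping.lookup m i) = (\<Sum>i\<in>Poly_Mapping.keys m. Poly_Mapping.lookup m i)"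
    using calculation by (intro sum.mono_neutral_right) (auto simp: in_keys_iff)
  ultimately show ?thesis by (simp add: mon_deg_def)
qed

lemma f4_power_4: "c ^ 4 = c" for c :: f4
  by (cases c) (simp_all add: eval_nat_numeral one_f4_def)

lemma eval4_homogeneous:
  assumes "is_form_P3 4 F"
  shows "eval4 F (\<lambda>i. c * x i) = c * eval4 F x"
  unfolding eval4_def sum_distrib_left
proof (rule sum.cong [OF refl])
  fix m assume m: "m \<in> Poly_Mapping.keys F"
  have "(\<Prod>i<4. (c * x i) ^ Poly_Mapping.lookup m i)
      = c ^ (\<Sum>i<4. Poly_Mapping.lookup m i) * (\<Prod>i<4. x i ^ Poly_Mapping.lookup m i)"
    by (simp add: power_mult_distrib prod.distrib power_sum)
  then show "Poly_Mapping.lookup F m * (\<Prod>i<4. (c * x i) ^ Poly_Mapping.lookup m i)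
      = c * (Poly_Mapping.lookup F m * (\<Prod>i<4. x i ^ Poly_Mapping.lookup m i))"
    by (simp add: is_form_degree [OF assms m] f4_power_4)
qed

lemma eval4_affine_orthogonal:
  assumes F: "is_form_P3 4 F"
  shows "(\<Sum>a\<in>UNIV. \<Sum>b\<in>UNIV. eval4 F (\<lambda>i. a * x i + b * y i + z i) * (k + l * a + n * b)) = 0"
proof -
  let ?g = "\<lambda>m a b. (\<Prod>i<4. (a * x i + b * y i + z i) ^ Poly_Mapping.lookup m i) * (k + l * a + n * b)"
  have "(\<Sum>a\<in>UNIV. \<Sum>b\<in>UNIV. eval4 F (\<lambda>i. a * x i + b * y i + z i) * (k + l * a + n * b))
      = (\<Sum>a\<in>UNIV. \<Sum>b\<in>UNIV. \<Sum>m\<in>Poly_Mapping.keys F. Poly_Mapping.lookup F m * ?g m a b)"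
    by (simp only: eval4_def sum_distrib_right mult.assoc)
  also have "\<dots> = (\<Sum>a\<in>UNIV. \<Sum>m\<in>Poly_Mapping.keys F. \<Sum>b\<in>UNIV. Poly_Mapping.lookup F m * ?g m a b)"
    by (rule sum.cong [OF refl]) (rule sum.swap)
  also have "\<dots> = (\<Sum>m\<in>Poly_Mapping.keys F. \<Sum>a\<in>UNIV. \<Sum>b\<in>UNIV. Poly_Mapping.lookup F m * ?g m a b)"
    by (rule sum.swap)
  also have "\<dots> = (\<Sum>m\<in>Poly_Mapping.keys F. Poly_Mapping.lookup F m * (\<Sum>a\<in>UNIV. \<Sum>b\<in>UNIV. ?g m a b))"
    by (simp only: sum_distrib_left)
  also have "\<dots> = (\<Sum>m\<in>Poly_Mapping.keys F. 0)"
  proof (rule sum.cong [OF refl])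
    fix m assume m: "m \<in> Poly_Mapping.keys F"
    \<comment> \<open>The affine function joins the four factors of the monomial as a fifth.\<close>
    let ?fs = "(l, n, k) # map (\<lambda>i. (x i, y i, z i)) (mon_list (Poly_Mapping.lookup m))"
    have "?g m a b = a ^ 0 * b ^ 0 * (\<Prod>(p, q, r)\<leftarrow>?fs. p * a + q * b + r)" for a b
      by (simp add: prod_mon_list [symmetric] comp_def mult_ac add_ac)
    then have "(\<Sum>a\<in>UNIV. \<Sum>b\<in>UNIV. ?g m a b)
        = (\<Sum>a\<in>UNIV. \<Sum>b\<in>UNIV. a ^ 0 * b ^ 0 * (\<Prod>(p, q, r)\<leftarrow>?fs. p * a + q * b + r))"
      by (simp only:)
    also have "\<dots> = 0"
      by (rule sum_affine_product) (simp add: length_mon_list is_form_degree [OF F m])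
    finally show "Poly_Mapping.lookup F m * (\<Sum>a\<in>UNIV. \<Sum>b\<in>UNIV. ?g m a b) = 0" by simp
  qed
  finally show ?thesis by simp
qed

text \<open>The degree 4 is less than the number of points of the projective line over F_4; the
  values at its five points determine the coefficients.\<close>

lemma binary_quartic_zero:
  fixes c :: "nat \<Rightarrow> f4"
  assumes zero: "\<And>s t. (\<Sum>k\<le>4. c k * s ^ k * t ^ (4 - k)) = 0" and k: "k \<le> 4"
  shows "c k = 0"
proof -
  have e: "c 0 * t ^ 4 + c 1 * s * t ^ 3 + c 2 * s ^ 2 * t ^ 2 + c 3 * s ^ 3 * t + c 4 * s ^ 4 = 0" for s t
    using zero [of s t] by (simp add: eval_nat_numeral)
  have 0: "c 0 = 0" using e [where s = 0 and t = 1] by simp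
  have 4: "c 4 = 0" using e [where s = 1 and t = 0] by simp
  have "c 1 + c 2 + c 3 = 0" using e [where s = 1 and t = 1] 0 4 by simp
  moreover have "c 1 + c 2 * Fb + c 3 * Fa = 0"
    using e [where s = 1 and t = Fa] 0 4 by (simp add: eval_nat_numeral one_f4_def [symmetric])
  moreover have "c 1 + c 2 * Fa + c 3 * Fb = 0"
    using e [where s = 1 and t = Fb] 0 4 by (simp add: eval_nat_numeral one_f4_def [symmetric])
  ultimately have "c 1 = 0 \<and> c 2 = 0 \<and> c 3 = 0"
    by (cases "c 1"; cases "c 2"; cases "c 3") (simp_all add: zero_f4_def)
  moreover have "k = 0 \<or> k = 1 \<or> k = 2 \<or> k = 3 \<or> k = 4" using k by linarith
  ultimately show ?thesis using 0 4 by auto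
qed

definition line_coeff :: "mpoly4 \<Rightarrow> (nat \<Rightarrow> f4) \<Rightarrow> (nat \<Rightarrow> f4) \<Rightarrow> nat \<Rightarrow> f4" where
  "line_coeff F P Q k = (\<Sum>m\<in>Poly_Mapping.keys F. Poly_Mapping.lookup F m *
    lin_coeff (map (\<lambda>i. (P i, Q i)) (mon_list (Poly_Mapping.lookup m))) k)"

lemma quartic_on_line:
  fixes \<phi> :: "f4 \<Rightarrow> 'a :: comm_ring_1"
  assumes F: "is_form_P3 4 F"
    and add: "\<And>a b. \<phi> (a + b) = \<phi> a + \<phi> b" and mult: "\<And>a b. \<phi> (a * b) = \<phi> a * \<phi> b" and one: "\<phi> 1 = 1"
  shows "(\<Sum>m\<in>Poly_Mapping.keys F. \<phi> (Poly_Mapping.lookup F m) *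
        (\<Prod>i<4. (\<phi> (P i) * S + \<phi> (Q i) * T) ^ Poly_Mapping.lookup m i))
      = (\<Sum>k\<le>4. \<phi> (line_coeff F P Q k) * S ^ k * T ^ (4 - k))"
proof -
  let ?fs = "\<lambda>m. map (\<lambda>i. (P i, Q i)) (mon_list (Poly_Mapping.lookup m))"
  have "\<phi> 0 = 0" using add [of 0 0] by simp
  then have \<phi>_sum: "\<phi> (sum g A) = (\<Sum>i\<in>A. \<phi> (g i))" for g and A :: "(nat \<Rightarrow>\<^sub>0 nat) set"
    by (induction A rule: infinite_finite_induct) (simp_all add: add)
  have "(\<Sum>m\<in>Poly_Mapping.keys F. \<phi> (Poly_Mapping.lookup F m) *
        (\<Prod>i<4. (\<phi> (P i) * S + \<phi> (Q i) * T) ^ Poly_Mapping.lookup m i))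
      = (\<Sum>m\<in>Poly_Mapping.keys F. \<phi> (Poly_Mapping.lookup F m) *
        (\<Sum>k\<le>4. \<phi> (lin_coeff (?fs m) k) * S ^ k * T ^ (4 - k)))"
  proof (rule sum.cong [OF refl])
    fix m assume m: "m \<in> Poly_Mapping.keys F"
    have "(\<Prod>i<4. (\<phi> (P i) * S + \<phi> (Q i) * T) ^ Poly_Mapping.lookup m i)
        = (\<Sum>k\<le>4. \<phi> (lin_coeff (?fs m) k) * S ^ k * T ^ (4 - k))"
      using prod_linear_forms [of \<phi> S T "?fs m", OF add mult one]
      by (simp add: prod_mon_list [symmetric] comp_def length_mon_list is_form_degree [OF F m])
    then show "\<phi> (Poly_Mapping.lookup F m) *
        (\<Prod>i<4. (\<phi> (P i) * S + \<phi> (Q i) * T) ^ Poly_Mapping.lookup m i)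
      = \<phi> (Poly_Mapping.lookup F m) * (\<Sum>k\<le>4. \<phi> (lin_coeff (?fs m) k) * S ^ k * T ^ (4 - k))"
      by simp
  qed
  also have "\<dots> = (\<Sum>k\<le>4. \<Sum>m\<in>Poly_Mapping.keys F. \<phi> (Poly_Mapping.lookup F m) *
        (\<phi> (lin_coeff (?fs m) k) * S ^ k * T ^ (4 - k)))"
    unfolding sum_distrib_left by (rule sum.swap)
  also have "\<dots> = (\<Sum>k\<le>4. \<phi> (line_coeff F P Q k) * S ^ k * T ^ (4 - k))"
    unfolding line_coeff_def \<phi>_sum by (simp add: mult sum_distrib_right mult.assoc)
  finally show ?thesis .
qed

text \<open>Values on the line and the formal restriction share the coefficients
  \<open>line_coeff\<close>, and \<open>binary_quartic_zero\<close> recovers these from the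
  values.\<close>

lemma restrict_line_eq_0:
  assumes F: "is_form_P3 4 F" and zero: "\<And>s t. eval4 F (\<lambda>i. s * P i + t * Q i) = 0"
  shows "restrict_line F P Q = 0"
proof -
  have "(\<Sum>k\<le>4. line_coeff F P Q k * s ^ k * t ^ (4 - k)) = 0" for s t
    using zero [of s t] quartic_on_line [OF F, of "\<lambda>a. a" P s Q t] by (simp add: eval4_def mult.commute)
  then have "line_coeff F P Q k = 0" if "k \<le> 4" for k
    using binary_quartic_zero that by blast
  then show ?thesis
    unfolding restrict_line_def
    by (subst quartic_on_line [OF F, of mconst]) (simp_all add: mconst_add mconst_mult mconst_1)
qed

section \<open>From vectors to projective points\<close>

text \<open>Identifies the finite type of quadruples, used for counting, with
  \<open>vec4\<close>.\<close>

fun emb :: "v4 \<Rightarrow> nat \<Rightarrow> f4" where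
  "emb (x, y, z, t) i = (if i = 0 then x else if i = 1 then y else if i = 2 then z else if i = 3 then t else 0)"

lemma emb_add: "emb (x + y) = (\<lambda>i. emb x i + emb y i)"
  by (cases x; cases y) (auto simp: fun_eq_iff)

lemma emb_scale: "emb (c \<cdot> x) = (\<lambda>i. c * emb x i)"
  by (cases x) (auto simp: fun_eq_iff)

lemma emb_eq_iff: "emb x = emb y \<longleftrightarrow> x = y"
proof
  obtain a b c d a' b' c' d' where xy: "x = (a, b, c, d)" "y = (a', b', c', d')"
    by (cases x; cases y)
  assume *: "emb x = emb y"
  show "x = y"
    using fun_cong [OF *, of 0] fun_cong [OF *, of 1] fun_cong [OF *, of 2] fun_cong [OF *, of 3]
    by (simp add: xy)
qed simp

lemma emb_0: "emb 0 = (\<lambda>_. 0)"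
  by (auto simp: zero_prod_def)

lemma range_emb: "range emb = vec4"
proof (intro equalityI subsetI)
  fix g assume "g \<in> range emb"
  then show "g \<in> vec4" by (auto simp: vec4_def)
next
  fix g assume "g \<in> vec4"
  then have "g i = 0" if "4 \<le> i" for i using that by (simp add: vec4_def)
  then have "g = emb (g 0, g 1, g 2, g 3)"
    by (auto simp: fun_eq_iff)
  then show "g \<in> range emb" by (rule range_eqI)
qed

lemma proj_class_eq:
  assumes "y \<in> proj_class x" shows "proj_class y = proj_class x"
proof -
  obtain c where c: "c \<noteq> 0" "y = (\<lambda>i. c * x i)" using assms by (auto simp: proj_class_def)
  show ?thesis
  proof (intro equalityI subsetI)
    fix v assume "v \<in> proj_class y"
    then obtain d where "d \<noteq> 0" "v = (\<lambda>i. d * y i)" by (auto simp: proj_class_def)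
    then have "d * c \<noteq> 0" "v = (\<lambda>i. (d * c) * x i)" using c by (auto simp: mult.assoc)
    then show "v \<in> proj_class x" unfolding proj_class_def by blast
  next
    fix v assume "v \<in> proj_class x"
    then obtain d where "d \<noteq> 0" "v = (\<lambda>i. d * x i)" by (auto simp: proj_class_def)
    then have "d / c \<noteq> 0" "v = (\<lambda>i. (d / c) * y i)" using c by auto
    then show "v \<in> proj_class y" unfolding proj_class_def by blast
  qed
qed

lemma card_proj_class:
  assumes "x \<noteq> (\<lambda>_. 0)" shows "card (proj_class x) = 3"
proof -
  obtain i where i: "x i \<noteq> 0" using assms by auto
  have "proj_class x = (\<lambda>c i. c * x i) ` (UNIV - {0})" by (auto simp: proj_class_def)
  moreover have "inj_on (\<lambda>c i. c * x i) (UNIV - {0})"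
  proof (rule inj_onI)
    fix c d assume "(\<lambda>i. c * x i) = (\<lambda>i. d * x i)"
    then have "c * x i = d * x i" by (rule fun_cong)
    then show "c = d" using i by simp
  qed
  ultimately show ?thesis by (simp add: card_image card_Diff_subset card_UNIV_f4)
qed

text \<open>Projective points are pairwise disjoint classes of three nonzero vectors each.\<close>

lemma card_N4:
  assumes "is_form_P3 4 F"
  shows "3 * N4 F \<le> card {v. v \<noteq> 0 \<and> eval4 F (emb v) = 0}"
proof -
  define Z where "Z = {p \<in> P3_F4. \<forall>x\<in>p. eval4 F x = 0}"
  have sub: "\<Union> Z \<subseteq> emb ` {v. v \<noteq> 0 \<and> eval4 F (emb v) = 0}"
  proof
    fix y assume "y \<in> \<Union> Z"
    then obtain x where x: "x \<in> vec4" "x \<noteq> (\<lambda>_. 0)" "y \<in> proj_class x" and y: "eval4 F y = 0"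
      by (auto simp: Z_def P3_F4_def)
    obtain v where v: "x = emb v" using x range_emb by blast
    obtain c where c: "c \<noteq> 0" "y = emb (c \<cdot> v)"
      using x by (auto simp: proj_class_def emb_scale v)
    have "v \<noteq> 0" using x emb_0 v by auto
    then show "y \<in> emb ` {v. v \<noteq> 0 \<and> eval4 F (emb v) = 0}"
      using c y by (auto intro!: image_eqI [of _ _ "c \<cdot> v"] simp: V4.scale_eq_0_iff)
  qed
  have finZ: "finite (\<Union> Z)" using sub by (rule finite_subset) simp
  have "3 * card Z = card (\<Union> Z)"
  proof (rule card_partition)
    show "finite Z" using finZ by (rule finite_UnionD)
    show "finite (\<Union> Z)" by (rule finZ)
    show "card c = 3" if "c \<in> Z" for c
      using that by (auto simp: Z_def P3_F4_def intro: card_proj_class)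
    show "c1 \<inter> c2 = {}" if c12: "c1 \<in> Z" "c2 \<in> Z" "c1 \<noteq> c2" for c1 c2
    proof (rule ccontr)
      assume "c1 \<inter> c2 \<noteq> {}"
      then obtain v where "v \<in> c1" "v \<in> c2" by blast
      moreover obtain x y where "c1 = proj_class x" "c2 = proj_class y"
        using c12 by (auto simp: Z_def P3_F4_def)
      ultimately show False using c12(3) proj_class_eq by metis
    qed
  qed
  also have "\<dots> \<le> card (emb ` {v. v \<noteq> 0 \<and> eval4 F (emb v) = 0})"
    by (rule card_mono) (use sub in auto)
  also have "\<dots> = card {v. v \<noteq> 0 \<and> eval4 F (emb v) = 0}"
    by (rule card_image) (auto simp: inj_on_def emb_eq_iff)
  finally show ?thesis by (simp add: N4_def Z_def)
qed

lemma quartic_function_eval4: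
  assumes F: "is_form_P3 4 F" and no_line: "\<not> contains_F4_line F"
  shows "quartic_function (\<lambda>x. eval4 F (emb x))"
proof
  show "eval4 F (emb (c \<cdot> x)) = c * eval4 F (emb x)" for c x
    by (simp add: emb_scale eval4_homogeneous [OF F])
  show "(\<Sum>(a, b)\<in>UNIV. eval4 F (emb (a \<cdot> x + b \<cdot> y + z)) * (k + l * a + m * b)) = 0" for x y z k l m
    using eval4_affine_orthogonal [OF F, of "emb x" "emb y" "emb z" k l m]
    by (simp add: emb_add emb_scale sum.cartesian_product)
  show "\<exists>a b. eval4 F (emb (a \<cdot> x + b \<cdot> y)) \<noteq> 0" if ind: "indep2 x y" for x y
  proof (rule ccontr)
    assume "\<not> ?thesis"
    then have "restrict_line F (emb x) (emb y) = 0"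
      by (intro restrict_line_eq_0 [OF F]) (simp add: emb_add emb_scale)
    moreover have "emb x \<in> vec4" "emb y \<in> vec4" using range_emb by blast+
    moreover have "emb x \<noteq> (\<lambda>_. 0)"
    proof
      assume "emb x = (\<lambda>_. 0)"
      then have "x = 0" using emb_eq_iff [of x 0] by (simp add: emb_0)
      then have "1 \<cdot> x + 0 \<cdot> y = 0" by simp
      then show False using ind unfolding indep2_def by (metis zero_neq_one)
    qed
    moreover have "emb y \<noteq> (\<lambda>i. c * emb x i)" for c
    proof
      assume "emb y = (\<lambda>i. c * emb x i)"
      then have "y = c \<cdot> x" by (simp add: emb_eq_iff flip: emb_scale)
      then have "(- c) \<cdot> x + 1 \<cdot> y = 0" by simp
      then show False using ind unfolding indep2_def by (metis zero_neq_one)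
    qed
    ultimately show False using no_line unfolding contains_F4_line_def by blast
  qed
qed

theorem theorem2p3:
  fixes F :: mpoly4
  assumes "is_form_P3 4 F"
    and "irreducible F"
    and "\<not> contains_F4_line F"
  shows "N4 F \<le> 51"
proof -
  interpret quartic_function "\<lambda>x. eval4 F (emb x)"
    using assms(1,3) by (rule quartic_function_eval4)
  \<comment> \<open>From 3 * \<open>N4 F\<close> \<le> 155 < 3 * 52.\<close>
  show ?thesis using card_N4 [OF assms(1)] card_zeros by simp
qed

end
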